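(* Let $\mathscr{C}_i=\{f_i=0\}\subset\mathbb{C}^2$, $i=1,\dots,n$, be algebraic curves defined by nonconstant reduced polynomials $f_i\in\mathbb{C}[x,y]$, no two of which share a common factor. Let $\mathcal{M}=\mathbb{C}^2\setminus\bigcup_{i=1}^n\mathscr{C}_i$ and $\omega_j=df_j/f_j$. For each $i$ let $\delta_i\in H_1(\mathcal{M};\mathbb{Z})$ be the homology class of a small loop that winds once positively around a smooth point of $\mathscr{C}_i$ lying on no other curve $\mathscr{C}_k$, $k\ne i$. Then $$\frac1{2\pi i}\oint_{\delta_i}\omega_j=\delta_{ij}\qquad(1\le i,j\le n),$$ where the right-hand side is the Kronecker delta. Consequently the de Rham cohomology classes $[\omega_1],\dots,[\omega_n]$ are linearly independent in $H^1(\mathcal{M};\mathbb{C})$.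
   Context: A loop winding once positively around a smooth point $p\in\mathscr{C}_i$ (a meridian): in local holomorphic coordinates $(z_1,z_2)$ centred at $p$ with $\mathscr{C}_i=\{z_1=0\}$, it is $t\mapsto(\epsilon e^{2\pi it},0)$, $t\in[0,1]$, with $\epsilon>0$ small enough that the corresponding disk meets no other curve of the arrangement. The forms $\omega_j$ are closed holomorphic $1$-forms on $\mathcal{M}$. *)

theory Defs
  imports
    "HOL-Complex_Analysis.Complex_Analysis"
    "HOL-Homology.Homology"
    "HOL-Computational_Algebra.Squarefree"
    "HOL-Algebra.Module"
begin

section \<open>Plane algebraic curves\<close>

text \<open>
  The ring \<open>\<complex>[x,y]\<close> is rendered as the iterated polynomial ring \<open>\<complex>[x][y]\<close>, i.e. the type
  \<^typ>\<open>complex poly poly\<close>; the outer variable is \<open>y\<close>. Its units are the nonzero constants, so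
  \<^const>\<open>coprime\<close> says that two polynomials have no common factor, and
  \<^const>\<open>squarefree\<close> says that a polynomial is reduced.
\<close>

definition eval2 :: "complex poly poly \<Rightarrow> complex \<times> complex \<Rightarrow> complex" where
  "eval2 f z = poly (poly f [:snd z:]) (fst z)"

definition nonconstant :: "complex poly poly \<Rightarrow> bool" where
  "nonconstant f \<longleftrightarrow> (\<nexists>c. f = [:[:c:]:])"

definition curve :: "complex poly poly \<Rightarrow> (complex \<times> complex) set" where
  "curve f = {z. eval2 f z = 0}"

definition curve_complement :: "nat \<Rightarrow> (nat \<Rightarrow> complex poly poly) \<Rightarrow> (complex \<times> complex) set" where
  "curve_complement n f = - (\<Union>i\<in>{1..n}. curve (f i))"


section \<open>Complex-valued differential 1-forms\<close>

text \<open>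
  A 1-form assigns to a point and a tangent vector a complex number. Only its values at points of
  the open set under consideration matter.
\<close>

type_synonym 'a one_form = "'a \<Rightarrow> 'a \<Rightarrow> complex"

text \<open>
  Continuous differentiability of order \<open>k\<close>, by iterated directional derivatives
  (on open subsets of a finite-dimensional space this is the usual notion).
\<close>

fun Ck_on :: "nat \<Rightarrow> 'a::real_normed_vector set \<Rightarrow> ('a \<Rightarrow> 'b::real_normed_vector) \<Rightarrow> bool" where
  "Ck_on 0 U g \<longleftrightarrow> continuous_on U g"
| "Ck_on (Suc k) U g \<longleftrightarrow> (\<forall>x\<in>U. g differentiable (at x)) \<and>
     (\<forall>v. Ck_on k U (\<lambda>x. frechet_derivative g (at x) v))"

definition smooth_on :: "'a::real_normed_vector set \<Rightarrow> ('a \<Rightarrow> 'b::real_normed_vector) \<Rightarrow> bool" where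
  "smooth_on U g \<longleftrightarrow> (\<forall>k. Ck_on k U g)"

definition smooth_one_form :: "'a::euclidean_space set \<Rightarrow> 'a one_form \<Rightarrow> bool" where
  "smooth_one_form U \<eta> \<longleftrightarrow> (\<forall>x\<in>U. linear (\<eta> x)) \<and> (\<forall>v. smooth_on U (\<lambda>x. \<eta> x v))"

text \<open>The exterior derivative is \<open>d\<eta>(u,v) = D\<^sub>u(\<eta>(v)) - D\<^sub>v(\<eta>(u))\<close> for constant \<open>u\<close>, \<open>v\<close>.\<close>

definition closed_one_form :: "'a::euclidean_space set \<Rightarrow> 'a one_form \<Rightarrow> bool" where
  "closed_one_form U \<eta> \<longleftrightarrow> smooth_one_form U \<eta> \<and>
     (\<forall>x\<in>U. \<forall>u v. frechet_derivative (\<lambda>y. \<eta> y v) (at x) u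
                 - frechet_derivative (\<lambda>y. \<eta> y u) (at x) v = 0)"

definition exact_one_form :: "'a::euclidean_space set \<Rightarrow> 'a one_form \<Rightarrow> bool" where
  "exact_one_form U \<eta> \<longleftrightarrow> (\<exists>g. smooth_on U g \<and> (\<forall>x\<in>U. \<eta> x = frechet_derivative g (at x)))"

definition dlog_form :: "complex poly poly \<Rightarrow> (complex \<times> complex) one_form" where
  "dlog_form f = (\<lambda>z v. frechet_derivative (eval2 f) (at z) v / eval2 f z)"


section \<open>First de Rham cohomology\<close>

definition complex_field :: "complex ring" where
  "complex_field = \<lparr>carrier = UNIV, mult = (*), one = 1, zero = 0, add = (+)\<rparr>"

definition deRham_class :: "'a::euclidean_space set \<Rightarrow> 'a one_form \<Rightarrow> 'a one_form set" where
  "deRham_class U \<eta> = {\<theta>. closed_one_form U \<theta> \<and> exact_one_form U (\<lambda>x v. \<theta> x v - \<eta> x v)}"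

text \<open>
  The complex vector space of closed forms modulo exact forms. The multiplicative fields
  of the module record are irrelevant.
\<close>

definition deRham_H1 :: "'a::euclidean_space set \<Rightarrow> (complex, 'a one_form set) module" where
  "deRham_H1 U =
     \<lparr>carrier = deRham_class U ` {\<eta>. closed_one_form U \<eta>},
      mult = undefined, one = undefined,
      zero = deRham_class U (\<lambda>x v. 0),
      add = (\<lambda>A B. \<Union>\<alpha>\<in>A. \<Union>\<beta>\<in>B. deRham_class U (\<lambda>x v. \<alpha> x v + \<beta> x v)),
      smult = (\<lambda>c A. \<Union>\<alpha>\<in>A. deRham_class U (\<lambda>x v. c * \<alpha> x v))\<rparr>"

lemma frechet_derivative_cong_open:
  assumes "open U" "x \<in> U" "\<And>y. y \<in> U \<Longrightarrow> g y = h y"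
  shows "frechet_derivative g (at x) = frechet_derivative h (at x)"
proof -
  have "(g has_derivative D) (at x) \<longleftrightarrow> (h has_derivative D) (at x)" for D
    using assms has_derivative_transform_within_open[of g D x UNIV U h]
      has_derivative_transform_within_open[of h D x UNIV U g] by auto
  then show ?thesis by (simp add: frechet_derivative_def)
qed

lemma Ck_on_cong:
  assumes "open U" "\<And>x. x \<in> U \<Longrightarrow> g x = h x" "Ck_on k U g"
  shows "Ck_on k U h"
  using assms
proof (induction k arbitrary: g h)
  case 0
  then show ?case by (auto cong: continuous_on_cong)
next
  case (Suc k)
  have "h differentiable (at x)" if "x \<in> U" for x
  proof -
    have "g differentiable (at x)"
      using Suc.prems(3) that by simp
    then obtain D where "(g has_derivative D) (at x)"
      unfolding differentiable_def by (elim exE)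
    then have "(h has_derivative D) (at x)"
      using has_derivative_transform_within_open[of g D x UNIV U h] Suc.prems(1,2) that by simp
    then show ?thesis by (auto simp: differentiable_def)
  qed
  moreover have "Ck_on k U (\<lambda>x. frechet_derivative h (at x) v)" for v
  proof (rule Suc.IH[OF \<open>open U\<close>])
    show "Ck_on k U (\<lambda>x. frechet_derivative g (at x) v)"
      using Suc.prems(3) by simp
    show "frechet_derivative g (at x) v = frechet_derivative h (at x) v" if "x \<in> U" for x
      using frechet_derivative_cong_open[OF \<open>open U\<close> that Suc.prems(2)] by simp
  qed
  ultimately show ?case by simp
qed

lemma frechet_derivative_add_at:
  assumes "g differentiable (at x)" "h differentiable (at x)"
  shows "frechet_derivative (\<lambda>y. g y + h y) (at x) =
    (\<lambda>v. frechet_derivative g (at x) v + frechet_derivative h (at x) v)"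
  using assms
  by (intro frechet_derivative_at[symmetric] has_derivative_add) (auto simp: frechet_derivative_works)

lemma frechet_derivative_cmult_at:
  fixes g :: "'a::real_normed_vector \<Rightarrow> complex"
  assumes "g differentiable (at x)"
  shows "frechet_derivative (\<lambda>y. c * g y) (at x) = (\<lambda>v. c * frechet_derivative g (at x) v)"
  using assms
  by (intro frechet_derivative_at[symmetric] has_derivative_mult_right) (auto simp: frechet_derivative_works)

lemma Ck_on_add:
  assumes "open U" "Ck_on k U g" "Ck_on k U h"
  shows "Ck_on k U (\<lambda>x. g x + h x)"
  using assms
proof (induction k arbitrary: g h)
  case (Suc k)
  have "Ck_on k U (\<lambda>x. frechet_derivative (\<lambda>y. g y + h y) (at x) v)" for v
  proof (rule Ck_on_cong[OF \<open>open U\<close>])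
    show "Ck_on k U (\<lambda>x. frechet_derivative g (at x) v + frechet_derivative h (at x) v)"
      using Suc by simp
  qed (use Suc.prems in \<open>simp add: frechet_derivative_add_at\<close>)
  then show ?case using Suc.prems by simp
qed (auto intro: continuous_intros)

lemma Ck_on_cmult:
  fixes g :: "'a::real_normed_vector \<Rightarrow> complex"
  assumes "open U" "Ck_on k U g"
  shows "Ck_on k U (\<lambda>x. c * g x)"
  using assms
proof (induction k arbitrary: g)
  case (Suc k)
  have "Ck_on k U (\<lambda>x. frechet_derivative (\<lambda>y. c * g y) (at x) v)" for v
  proof (rule Ck_on_cong[OF \<open>open U\<close>])
    show "Ck_on k U (\<lambda>x. c * frechet_derivative g (at x) v)"
      using Suc by simp
  qed (use Suc.prems in \<open>simp add: frechet_derivative_cmult_at\<close>)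
  then show ?case using Suc.prems by (auto intro: differentiable_mult)
qed (auto intro: continuous_intros)

lemma Ck_on_zero: "Ck_on k U (\<lambda>x. 0)"
  by (induction k) (auto simp: frechet_derivative_const)

lemma smooth_onD: "smooth_on U g \<Longrightarrow> x \<in> U \<Longrightarrow> g differentiable (at x)"
  unfolding smooth_on_def by (metis Ck_on.simps(2))

lemma smooth_on_add:
  "open U \<Longrightarrow> smooth_on U g \<Longrightarrow> smooth_on U h \<Longrightarrow> smooth_on U (\<lambda>x. g x + h x)"
  by (simp add: smooth_on_def Ck_on_add)

lemma smooth_on_cmult:
  "open U \<Longrightarrow> smooth_on U g \<Longrightarrow> smooth_on U (\<lambda>x. (c::complex) * g x)"
  by (simp add: smooth_on_def Ck_on_cmult)

lemma closed_one_form_zero: "closed_one_form U (\<lambda>x v. 0)"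
  by (auto simp: closed_one_form_def smooth_one_form_def smooth_on_def Ck_on_zero
        module_hom_zero linear_iff)

lemma closed_one_form_add:
  assumes "open U" "closed_one_form U \<alpha>" "closed_one_form U \<beta>"
  shows "closed_one_form U (\<lambda>x v. \<alpha> x v + \<beta> x v)"
proof -
  have "(\<lambda>y. \<alpha> y v) differentiable (at x)" "(\<lambda>y. \<beta> y v) differentiable (at x)" if "x \<in> U" for x v
    using assms that by (auto simp: closed_one_form_def smooth_one_form_def intro: smooth_onD)
  then show ?thesis
    using assms by (auto simp: closed_one_form_def smooth_one_form_def smooth_on_add
        frechet_derivative_add_at linear_compose_add)
qed

lemma closed_one_form_cmult:
  assumes "open U" "closed_one_form U \<alpha>"
  shows "closed_one_form U (\<lambda>x v. c * \<alpha> x v)"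
proof -
  have "(\<lambda>y. \<alpha> y v) differentiable (at x)" if "x \<in> U" for x v
    using assms that by (auto simp: closed_one_form_def smooth_one_form_def intro: smooth_onD)
  then show ?thesis
    using assms by (auto simp: closed_one_form_def smooth_one_form_def smooth_on_cmult
        frechet_derivative_cmult_at linear_iff algebra_simps)
qed

lemma exact_one_form_zero: "exact_one_form U (\<lambda>x v. 0)"
  unfolding exact_one_form_def
  by (rule exI[of _ "\<lambda>x. 0"]) (simp add: smooth_on_def Ck_on_zero frechet_derivative_const)

lemma exact_one_form_add:
  assumes "open U" "exact_one_form U \<alpha>" "exact_one_form U \<beta>"
  shows "exact_one_form U (\<lambda>x v. \<alpha> x v + \<beta> x v)"
proof -
  obtain g h where "smooth_on U g" "\<forall>x\<in>U. \<alpha> x = frechet_derivative g (at x)"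
    "smooth_on U h" "\<forall>x\<in>U. \<beta> x = frechet_derivative h (at x)"
    using assms unfolding exact_one_form_def by blast
  then show ?thesis
    unfolding exact_one_form_def using assms(1)
    by (intro exI[of _ "\<lambda>x. g x + h x"])
       (auto simp: smooth_on_add frechet_derivative_add_at smooth_onD)
qed

lemma exact_one_form_cmult:
  assumes "open U" "exact_one_form U \<alpha>"
  shows "exact_one_form U (\<lambda>x v. c * \<alpha> x v)"
proof -
  obtain g where "smooth_on U g" "\<forall>x\<in>U. \<alpha> x = frechet_derivative g (at x)"
    using assms unfolding exact_one_form_def by blast
  then show ?thesis
    unfolding exact_one_form_def using assms(1)
    by (intro exI[of _ "\<lambda>x. c * g x"])
       (auto simp: smooth_on_cmult frechet_derivative_cmult_at dest: smooth_onD)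
qed

lemma deRham_class_self: "closed_one_form U \<eta> \<Longrightarrow> \<eta> \<in> deRham_class U \<eta>"
  by (simp add: deRham_class_def exact_one_form_zero)

lemma deRham_class_subset:
  assumes "open U" "exact_one_form U (\<lambda>x v. \<alpha> x v - \<beta> x v)"
  shows "deRham_class U \<alpha> \<subseteq> deRham_class U \<beta>"
  using exact_one_form_add[OF assms(1) _ assms(2)] by (fastforce simp: deRham_class_def)

lemma deRham_class_eqI:
  assumes "open U" "exact_one_form U (\<lambda>x v. \<alpha> x v - \<beta> x v)"
  shows "deRham_class U \<alpha> = deRham_class U \<beta>"
  using deRham_class_subset[OF assms]
    deRham_class_subset[OF assms(1), of \<beta> \<alpha>] exact_one_form_cmult[OF assms, of "-1"] by simp

lemma deRham_class_eq_iff: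
  assumes "open U" "closed_one_form U \<alpha>"
  shows "deRham_class U \<alpha> = deRham_class U \<beta> \<longleftrightarrow> exact_one_form U (\<lambda>x v. \<alpha> x v - \<beta> x v)"
proof
  assume "deRham_class U \<alpha> = deRham_class U \<beta>"
  then have "\<alpha> \<in> deRham_class U \<beta>"
    using deRham_class_self[OF assms(2)] by simp
  then show "exact_one_form U (\<lambda>x v. \<alpha> x v - \<beta> x v)"
    by (simp add: deRham_class_def)
qed (rule deRham_class_eqI[OF assms(1)])

lemma deRham_H1_add:
  assumes "open U" "closed_one_form U \<alpha>" "closed_one_form U \<beta>"
  shows "deRham_class U \<alpha> \<oplus>\<^bsub>deRham_H1 U\<^esub> deRham_class U \<beta>
       = deRham_class U (\<lambda>x v. \<alpha> x v + \<beta> x v)"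
proof -
  have "deRham_class U (\<lambda>x v. \<alpha>' x v + \<beta>' x v) = deRham_class U (\<lambda>x v. \<alpha> x v + \<beta> x v)"
    if "\<alpha>' \<in> deRham_class U \<alpha>" "\<beta>' \<in> deRham_class U \<beta>" for \<alpha>' \<beta>'
  proof (rule deRham_class_eqI[OF assms(1)])
    have "exact_one_form U (\<lambda>x v. (\<alpha>' x v - \<alpha> x v) + (\<beta>' x v - \<beta> x v))"
      using that assms(1) by (intro exact_one_form_add) (auto simp: deRham_class_def)
    then show "exact_one_form U (\<lambda>x v. \<alpha>' x v + \<beta>' x v - (\<alpha> x v + \<beta> x v))"
      by (simp add: algebra_simps)
  qed
  then have "(\<Union>\<alpha>'\<in>deRham_class U \<alpha>. \<Union>\<beta>'\<in>deRham_class U \<beta>. deRham_class U (\<lambda>x v. \<alpha>' x v + \<beta>' x v))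
    = (\<Union>\<alpha>'\<in>deRham_class U \<alpha>. \<Union>\<beta>'\<in>deRham_class U \<beta>. deRham_class U (\<lambda>x v. \<alpha> x v + \<beta> x v))"
    by (intro SUP_cong refl)
  moreover have "deRham_class U \<alpha> \<noteq> {}" "deRham_class U \<beta> \<noteq> {}"
    using assms deRham_class_self by fast+
  ultimately show ?thesis
    by (simp add: deRham_H1_def)
qed

lemma deRham_H1_smult:
  assumes "open U" "closed_one_form U \<alpha>"
  shows "c \<odot>\<^bsub>deRham_H1 U\<^esub> deRham_class U \<alpha> = deRham_class U (\<lambda>x v. c * \<alpha> x v)"
proof -
  have "deRham_class U (\<lambda>x v. c * \<alpha>' x v) = deRham_class U (\<lambda>x v. c * \<alpha> x v)"
    if "\<alpha>' \<in> deRham_class U \<alpha>" for \<alpha>'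
  proof (rule deRham_class_eqI[OF assms(1)])
    have "exact_one_form U (\<lambda>x v. c * (\<alpha>' x v - \<alpha> x v))"
      using that assms(1) by (intro exact_one_form_cmult) (auto simp: deRham_class_def)
    then show "exact_one_form U (\<lambda>x v. c * \<alpha>' x v - c * \<alpha> x v)"
      by (simp add: algebra_simps)
  qed
  then have "(\<Union>\<alpha>'\<in>deRham_class U \<alpha>. deRham_class U (\<lambda>x v. c * \<alpha>' x v))
    = (\<Union>\<alpha>'\<in>deRham_class U \<alpha>. deRham_class U (\<lambda>x v. c * \<alpha> x v))"
    by (intro SUP_cong refl)
  moreover have "deRham_class U \<alpha> \<noteq> {}"
    using assms deRham_class_self by fast
  ultimately show ?thesis
    by (simp add: deRham_H1_def)
qed

lemma cring_complex_field: "cring complex_field"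
proof (rule cringI)
  show "abelian_group complex_field"
    by (rule abelian_groupI)
       (auto simp: complex_field_def algebra_simps, metis add.right_inverse)
  show "comm_monoid complex_field"
    by (rule comm_monoidI) (auto simp: complex_field_def)
qed (auto simp: complex_field_def algebra_simps)

lemma module_deRham_H1:
  assumes U: "open U"
  shows "module complex_field (deRham_H1 U)"
proof -
  have carr: "carrier (deRham_H1 U) = deRham_class U ` {\<eta>. closed_one_form U \<eta>}"
    and zero: "\<zero>\<^bsub>deRham_H1 U\<^esub> = deRham_class U (\<lambda>x v. 0)"
    by (simp_all add: deRham_H1_def)
  note closed = closed_one_form_zero closed_one_form_add[OF U] closed_one_form_cmult[OF U]
  note ops = deRham_H1_add[OF U] deRham_H1_smult[OF U] closed
  show ?thesis
  proof (rule moduleI)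
    show "abelian_group (deRham_H1 U)"
    proof (rule abelian_groupI)
      fix A assume "A \<in> carrier (deRham_H1 U)"
      then obtain \<alpha> where \<alpha>: "A = deRham_class U \<alpha>" "closed_one_form U \<alpha>"
        by (auto simp: carr)
      have "deRham_class U (\<lambda>x v. -1 * \<alpha> x v) \<oplus>\<^bsub>deRham_H1 U\<^esub> A = \<zero>\<^bsub>deRham_H1 U\<^esub>"
        using \<alpha> closed(3)[OF \<alpha>(2), of "-1"] by (simp add: ops zero)
      then show "\<exists>B\<in>carrier (deRham_H1 U). B \<oplus>\<^bsub>deRham_H1 U\<^esub> A = \<zero>\<^bsub>deRham_H1 U\<^esub>"
        using closed(3)[OF \<alpha>(2), of "-1"] unfolding carr by blast
    qed (auto simp: carr zero ops algebra_simps)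
  qed (use cring_complex_field in \<open>auto simp: carr ops complex_field_def algebra_simps\<close>)
qed


section \<open>Integration over homology classes\<close>

definition line_integral :: "'a::euclidean_space one_form \<Rightarrow> (real \<Rightarrow> 'a) \<Rightarrow> complex" where
  "line_integral \<eta> \<gamma> = integral {0..1} (\<lambda>t. \<eta> (\<gamma> t) (vector_derivative \<gamma> (at t within {0..1})))"

text \<open>
  A path \<open>\<gamma>\<close> and the corresponding singular 1-simplex, whose 0th and 1st vertex are
  \<open>\<gamma> 0\<close> and \<open>\<gamma> 1\<close>.
\<close>

definition path_simplex :: "(real \<Rightarrow> 'a) \<Rightarrow> (nat \<Rightarrow> real) \<Rightarrow> 'a" where
  "path_simplex \<gamma> = restrict (\<lambda>s. \<gamma> (s 1)) (standard_simplex 1)"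

definition simplex_path :: "((nat \<Rightarrow> real) \<Rightarrow> 'a) \<Rightarrow> real \<Rightarrow> 'a" where
  "simplex_path \<sigma> t = \<sigma> (\<lambda>k. if k = 0 then 1 - t else if k = 1 then t else 0)"

lemma simplex_path_path_simplex:
  assumes "t \<in> {0..1}"
  shows "simplex_path (path_simplex \<gamma>) t = \<gamma> t"
  using assms by (auto simp: simplex_path_def path_simplex_def standard_simplex_def)

definition chain_integral :: "'a::euclidean_space one_form \<Rightarrow> 'a chain \<Rightarrow> complex" where
  "chain_integral \<eta> c =
     (\<Sum>\<sigma>\<in>Poly_Mapping.keys c. of_int (Poly_Mapping.lookup c \<sigma>) * line_integral \<eta> (simplex_path \<sigma>))"

definition piecewise_C1_chain :: "'a::euclidean_space chain \<Rightarrow> bool" where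
  "piecewise_C1_chain c \<longleftrightarrow> (\<forall>\<sigma>\<in>Poly_Mapping.keys c. valid_path (simplex_path \<sigma>))"

text \<open>
  The integral of a closed form over a class in first singular homology (a set of homologous
  cycles): the common value of the integrals over all piecewise \<open>C\<^sup>1\<close> cycles in the class.
\<close>

definition class_integral :: "'a::euclidean_space one_form \<Rightarrow> 'a chain set \<Rightarrow> complex" where
  "class_integral \<eta> A = (THE I. \<forall>c\<in>A. piecewise_C1_chain c \<longrightarrow> chain_integral \<eta> c = I)"

definition loop_class :: "'a::euclidean_space set \<Rightarrow> (real \<Rightarrow> 'a) \<Rightarrow> 'a chain set" where
  "loop_class U \<gamma> = homologous_rel_set 1 (top_of_set U) {} (frag_of (path_simplex \<gamma>))"

lemma loop_class_in_homology_group: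
  assumes "path \<gamma>" "path_image \<gamma> \<subseteq> U" "pathfinish \<gamma> = pathstart \<gamma>"
  shows "loop_class U \<gamma> \<in> carrier (homology_group 1 (top_of_set U))"
proof -
  let ?T = "subtopology (powertop_real UNIV) (standard_simplex 1)"
  have 1: "continuous_map ?T (top_of_set {0..1}) (\<lambda>s. s 1)"
    by (auto simp: continuous_map_in_subtopology standard_simplex_def
        intro!: continuous_map_from_subtopology continuous_map_product_projection)
  have 2: "continuous_map (top_of_set {0..1}) (top_of_set U) \<gamma>"
    using assms by (auto simp: path_def path_image_def)
  have simplex: "singular_simplex 1 (top_of_set U) (path_simplex \<gamma>)"
    using continuous_map_compose[OF 1 2]
    by (auto simp: singular_simplex_def path_simplex_def o_def intro: continuous_map_eq)
  have "singular_face 1 0 (path_simplex \<gamma>) = singular_face 1 1 (path_simplex \<gamma>)"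
    using assms(3)
    by (auto simp: singular_face_def path_simplex_def standard_simplex_0 simplical_face_def
        pathstart_def pathfinish_def standard_simplex_def restrict_def fun_eq_iff)
  then have "chain_boundary 1 (frag_of (path_simplex \<gamma>)) = 0"
    by (simp add: chain_boundary_of)
  then have "singular_relcycle 1 (top_of_set U) {} (frag_of (path_simplex \<gamma>))"
    using simplex by (simp add: singular_cycle singular_chain_of)
  then show ?thesis
    using carrier_relative_homology_group[of 1 "top_of_set U" "{}"] by (auto simp: loop_class_def)
qed


section \<open>Meridians\<close>

text \<open>
  Holomorphic maps in two variables: complex differentiable at each point, i.e.
  real differentiable with complex linear derivative.
\<close>

definition cscale :: "complex \<Rightarrow> complex \<times> complex \<Rightarrow> complex \<times> complex" where
  "cscale c v = (c * fst v, c * snd v)"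

definition holomorphic2_on ::
    "(complex \<times> complex \<Rightarrow> complex \<times> complex) \<Rightarrow> (complex \<times> complex) set \<Rightarrow> bool" where
  "holomorphic2_on F U \<longleftrightarrow>
     (\<forall>z\<in>U. \<exists>D. (F has_derivative D) (at z) \<and> (\<forall>c v. D (cscale c v) = cscale c (D v)))"

text \<open>Local holomorphic coordinates \<open>\<phi> = (z\<^sub>1, z\<^sub>2)\<close> on \<open>U\<close>, centred at \<open>p\<close>.\<close>

definition local_coordinates ::
    "(complex \<times> complex) set \<Rightarrow> (complex \<times> complex \<Rightarrow> complex \<times> complex) \<Rightarrow> complex \<times> complex \<Rightarrow> bool"
  where
  "local_coordinates U \<phi> p \<longleftrightarrow> open U \<and> p \<in> U \<and> \<phi> p = 0 \<and>
     holomorphic2_on \<phi> U \<and> inj_on \<phi> U \<and> open (\<phi> ` U) \<and> holomorphic2_on (inv_into U \<phi>) (\<phi> ` U)"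

text \<open>
  \<open>C\<close> is a family of curves indexed by \<open>I\<close>, and \<open>\<gamma>\<close> is a meridian of \<open>C i\<close>. The coordinates in
  which \<open>C i\<close> becomes \<open>{z\<^sub>1 = 0}\<close> say that the centre \<open>p\<close> is a smooth point of \<open>C i\<close>.
\<close>

definition is_meridian ::
    "'i set \<Rightarrow> ('i \<Rightarrow> (complex \<times> complex) set) \<Rightarrow> 'i \<Rightarrow> (real \<Rightarrow> complex \<times> complex) \<Rightarrow> bool" where
  "is_meridian I C i \<gamma> \<longleftrightarrow> (\<exists>p U \<phi> \<epsilon>.
     p \<in> C i \<and> (\<forall>k\<in>I - {i}. p \<notin> C k) \<and>
     local_coordinates U \<phi> p \<and> \<phi> ` (C i \<inter> U) = {w \<in> \<phi> ` U. fst w = 0} \<and>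
     \<epsilon> > 0 \<and> (\<forall>w\<in>cball 0 \<epsilon>. (w, 0) \<in> \<phi> ` U \<and> (\<forall>k\<in>I - {i}. inv_into U \<phi> (w, 0) \<notin> C k)) \<and>
     (\<forall>t\<in>{0..1}. \<gamma> t = inv_into U \<phi> (of_real \<epsilon> * exp (2 * of_real pi * \<i> * of_real t), 0)))"

definition meridian_class ::
    "nat \<Rightarrow> (nat \<Rightarrow> complex poly poly) \<Rightarrow> nat \<Rightarrow> (complex \<times> complex) chain set \<Rightarrow> bool" where
  "meridian_class n f i \<delta> \<longleftrightarrow> (\<exists>\<gamma>. is_meridian {1..n} (\<lambda>k. curve (f k)) i \<gamma> \<and>
     \<delta> = loop_class (curve_complement n f) \<gamma>)"

end

theory Submission
  imports Defs
    "HOL-Computational_Algebra.Computational_Algebra"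
    "HOL-Computational_Algebra.Field_as_Ring"
begin

text \<open>
  On \<open>M\<close> each \<open>\<omega>\<^sub>j = df\<^sub>j / f\<^sub>j\<close> is the pullback of \<open>dw / w\<close> under \<open>f\<^sub>j : M \<rightarrow> \<complex> - {0}\<close>. So its
  integral along a path \<open>\<gamma>\<close> is \<open>2 \<pi> \<i>\<close> times the winding number of \<open>f\<^sub>j \<circ> \<gamma>\<close> around \<open>0\<close>
  (\<open>has_integral_dlog_form\<close>), a quantity that makes sense for continuous paths. Extended additively
  to singular 1-chains it vanishes on boundaries, because a singular 2-simplex in \<open>M\<close> is mapped by
  \<open>f\<^sub>j\<close> into \<open>\<complex> - {0}\<close>, where the two ways around it are homotopic (\<open>winding_number_triangle\<close>).
  Hence the integral over a homology class is the integral over any piecewise \<open>C\<^sup>1\<close> cycle in it,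
  even where the 2-chains between such cycles are merely continuous (\<open>class_integral_dlog_form\<close>).

  Let \<open>\<gamma>\<close> be a meridian of the \<open>i\<close>-th curve. For \<open>j \<noteq> i\<close> the function \<open>f\<^sub>j\<close> has no zero on the disc
  that \<open>\<gamma>\<close> bounds, so the winding number is \<open>0\<close>. For \<open>j = i\<close> the only zero is the centre, and the
  point is that its multiplicity is one. This is where reducedness enters: a squarefree polynomial
  and its two partial derivatives have only finitely many common zeros
  (\<open>finite_singular_points\<close>), which follows from a weak form of Bezout's theorem
  (\<open>finite_common_zeros_prime\<close>). The curve near the centre is a disc \<open>{z\<^sub>1 = 0}\<close> of infinitely many
  points, so some point \<open>(0, s)\<close> close to the centre is not a common zero. Moving the disc to
  \<open>{z\<^sub>2 = s}\<close> keeps its boundary off the curve, hence keeps the winding number, and there the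
  derivative of \<open>f\<^sub>i\<close> across the curve is nonzero, so the winding number is \<open>1\<close>
  (\<open>winding_number_transverse_circle\<close>).

  For linear independence a loop \<open>\<gamma>\<close> suffices on which \<open>f\<^sub>i\<close> has some nonzero winding number and the
  other \<open>f\<^sub>j\<close> have winding number \<open>0\<close>. Such a loop is a small circle, in a complex line on which
  \<open>f\<^sub>i\<close> is not identically zero, around a point of the \<open>i\<close>-th curve off the other curves; the point
  exists since the curve is infinite and meets the others in finitely many points
  (\<open>loop_with_one_nonzero_winding_number\<close>). Along \<open>\<gamma>\<close> an exact form integrates to \<open>0\<close>, whereas
  \<open>\<Sum>\<^sub>j c\<^sub>j \<omega>\<^sub>j\<close> integrates to a nonzero multiple of \<open>c\<^sub>i\<close>.
\<close>

section \<open>Evaluation and partial derivatives of polynomials in two variables\<close>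

lemma eval2_pCons: "eval2 (pCons a p) z = poly a (fst z) + snd z * eval2 p z"
  by (simp add: eval2_def)

lemma eval2_0 [simp]: "eval2 0 z = 0"
  by (simp add: eval2_def)

lemma eval2_add: "eval2 (p + q) z = eval2 p z + eval2 q z"
  by (simp add: eval2_def)

lemma eval2_diff: "eval2 (p - q) z = eval2 p z - eval2 q z"
  by (simp add: eval2_def)

lemma eval2_mult: "eval2 (p * q) z = eval2 p z * eval2 q z"
  by (simp add: eval2_def)

lemma eval2_smult: "eval2 (Polynomial.smult a p) z = poly a (fst z) * eval2 p z"
  by (simp add: eval2_def)

lemma eval2_const: "eval2 [:a:] z = poly a (fst z)"
  by (simp add: eval2_def)

text \<open>
  Substituting a value for \<open>x\<close> coefficientwise gives the univariate polynomial in \<open>y\<close> that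
  describes \<open>p\<close> on a vertical line.
\<close>

lemma poly_fibre_eq_eval2: "poly (map_poly (\<lambda>a. poly a x) p) y = eval2 p (x, y)"
  by (induction p) (simp_all add: map_poly_pCons eval2_pCons)

definition pderiv_x :: "complex poly poly \<Rightarrow> complex poly poly" where
  "pderiv_x = map_poly pderiv"

lemma pderiv_x_0 [simp]: "pderiv_x 0 = 0"
  by (simp add: pderiv_x_def)

lemma pderiv_x_pCons: "pderiv_x (pCons a p) = pCons (pderiv a) (pderiv_x p)"
  by (simp add: pderiv_x_def map_poly_pCons)

lemma coeff_pderiv_x: "Polynomial.coeff (pderiv_x p) k = pderiv (Polynomial.coeff p k)"
  by (simp add: pderiv_x_def coeff_map_poly)

lemma pderiv_x_add: "pderiv_x (p + q) = pderiv_x p + pderiv_x q"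
  by (simp add: poly_eq_iff coeff_pderiv_x pderiv_add)

lemma pderiv_x_mult: "pderiv_x (p * q) = pderiv_x p * q + p * pderiv_x q"
proof (induction p)
  case (pCons a p)
  have smult: "pderiv_x (Polynomial.smult a r)
    = Polynomial.smult (pderiv a) r + Polynomial.smult a (pderiv_x r)" for r
    by (simp add: poly_eq_iff coeff_pderiv_x pderiv_mult mult.commute)
  show ?case
    by (simp add: pderiv_x_pCons pderiv_x_add smult pCons.IH algebra_simps)
qed (simp add: pderiv_x_def)

lemma pderiv_x_pderiv_commute: "pderiv_x (pderiv p) = pderiv (pderiv_x p)"
proof -
  have "pderiv (of_nat n * a) = of_nat n * pderiv a" for n and a :: "complex poly"
    by (simp add: pderiv_mult pderiv_of_nat)
  then show ?thesis
    unfolding poly_eq_iff by (metis coeff_pderiv coeff_pderiv_x)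
qed

definition dir_pderiv :: "complex \<times> complex \<Rightarrow> complex poly poly \<Rightarrow> complex poly poly" where
  "dir_pderiv v q = [:[:fst v:]:] * (pderiv_x q) + [:[:snd v:]:] * (pderiv q)"

lemma eval2_dir_pderiv:
  "eval2 (dir_pderiv v q) z = fst v * eval2 (pderiv_x q) z + snd v * eval2 (pderiv q) z"
  by (simp add: dir_pderiv_def eval2_add eval2_smult)

lemma has_derivative_eval2: "(eval2 q has_derivative (\<lambda>v. eval2 (dir_pderiv v q) z)) (at z)"
proof (induction q)
  case 0
  have "eval2 0 = (\<lambda>z. 0)" by auto
  moreover have "dir_pderiv v 0 = 0" for v
    by (simp add: dir_pderiv_def pderiv_x_def)
  ultimately show ?case by simp
next
  case (pCons a q)
  have "(poly a has_derivative (\<lambda>w. poly (pderiv a) (fst z) * w)) (at (fst z))"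
    using poly_DERIV[of a "fst z"] by (simp add: has_field_derivative_def)
  then have 1: "((\<lambda>z. poly a (fst z)) has_derivative (\<lambda>v. poly (pderiv a) (fst z) * fst v)) (at z)"
    by (rule has_derivative_compose[rotated]) (auto intro!: derivative_eq_intros)
  have "((\<lambda>z. poly a (fst z) + snd z * eval2 q z) has_derivative
    (\<lambda>v. poly (pderiv a) (fst z) * fst v
         + (snd z * eval2 (dir_pderiv v q) z + snd v * eval2 q z))) (at z)"
    by (intro has_derivative_add 1 has_derivative_mult has_derivative_snd has_derivative_ident
        pCons.IH)
  moreover have "eval2 (pCons a q) = (\<lambda>z. poly a (fst z) + snd z * eval2 q z)"
    by (auto simp: eval2_pCons)
  moreover have "eval2 (dir_pderiv v (pCons a q)) z = poly (pderiv a) (fst z) * fst v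
      + (snd z * eval2 (dir_pderiv v q) z + snd v * eval2 q z)" for v
    by (simp add: eval2_dir_pderiv pderiv_x_pCons pderiv_pCons eval2_pCons eval2_add algebra_simps)
  ultimately show ?case by simp
qed

lemma frechet_derivative_eval2: "frechet_derivative (eval2 q) (at z) v = eval2 (dir_pderiv v q) z"
  using frechet_derivative_at[OF has_derivative_eval2[of q z]] by metis

lemma continuous_on_eval2 [continuous_intros]:
  "continuous_on A g \<Longrightarrow> continuous_on A (\<lambda>x. eval2 q (g x))"
proof -
  have "continuous_on UNIV (eval2 q)"
    using has_derivative_continuous[OF has_derivative_eval2] by (simp add: continuous_on_eq_continuous_at)
  then show "continuous_on A g \<Longrightarrow> continuous_on A (\<lambda>x. eval2 q (g x))"
    by (rule continuous_on_compose2) auto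
qed

lemma open_curve_complement: "open (curve_complement n f)"
proof -
  have "closed (curve (f i))" for i
    unfolding curve_def
    by (intro closed_Collect_eq continuous_on_eval2 continuous_intros)
  then show ?thesis
    by (auto simp: curve_complement_def)
qed

section \<open>Intersections and singular points of plane curves\<close>

text \<open>
  Elimination of \<open>y\<close>. Take a nonzero element \<open>s\<close> of least degree in \<open>y\<close> in the ideal generated by
  \<open>p\<close> and \<open>h\<close>. By pseudo-division \<open>s\<close> divides every element of the ideal up to a factor in
  \<open>\<complex>[x]\<close>, in particular \<open>p\<close> and \<open>h\<close>. If \<open>s\<close> involved \<open>y\<close>, primality would force \<open>p\<close> to divide
  \<open>s\<close>, hence \<open>h\<close>, or to divide the cofactor of \<open>s\<close>, making \<open>s\<close> a divisor of an element of
  \<open>\<complex>[x]\<close>.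
\<close>

lemma prime_elimination:
  fixes p h :: "complex poly poly"
  assumes p: "prime p" and h: "\<not> p dvd h"
  obtains r a b where "r \<noteq> 0" "[:r:] = a * p + b * h"
proof -
  define J where "J = {a * p + b * h | a b. True}"
  have "p \<in> J"
    unfolding J_def by (rule CollectI, rule exI[of _ 1], rule exI[of _ 0]) simp
  have "h \<in> J"
    unfolding J_def by (rule CollectI, rule exI[of _ 0], rule exI[of _ 1]) simp
  have J_mult: "c * s \<in> J" if "s \<in> J" for c s
  proof -
    obtain a b where "s = a * p + b * h" using \<open>s \<in> J\<close> by (auto simp: J_def)
    then have "c * s = (c * a) * p + (c * b) * h" by (simp add: algebra_simps)
    then show ?thesis by (auto simp: J_def)
  qed
  have J_diff: "s - t \<in> J" if st: "s \<in> J" "t \<in> J" for s t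
  proof -
    obtain a b a' b' where "s = a * p + b * h" "t = a' * p + b' * h"
      using st unfolding J_def by blast
    then have "s - t = (a - a') * p + (b - b') * h" by (simp add: algebra_simps)
    then show ?thesis by (auto simp: J_def)
  qed
  have "\<exists>s. s \<in> J \<and> s \<noteq> 0" using \<open>p \<in> J\<close> p by auto
  then obtain s where s: "s \<in> J" "s \<noteq> 0"
    and min: "\<And>t. t \<in> J \<Longrightarrow> t \<noteq> 0 \<Longrightarrow> degree s \<le> degree t"
    using ex_has_least_nat[of "\<lambda>s. s \<in> J \<and> s \<noteq> 0" _ degree] by blast
  have s_dvd: "\<exists>c. c \<noteq> 0 \<and> s dvd [:c:] * t" if "t \<in> J" for t
  proof -
    obtain q r where qr: "pseudo_divmod t s = (q, r)" by fastforce
    define c where "c = Polynomial.coeff s (degree s) ^ (Suc (degree t) - degree s)"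
    have eq: "Polynomial.smult c t = s * q + r" and r: "r = 0 \<or> degree r < degree s"
      unfolding c_def using pseudo_divmod[OF \<open>s \<noteq> 0\<close> qr] by blast+
    have "r = [:c:] * t - q * s" using eq by (simp add: algebra_simps)
    then have "r \<in> J" by (simp only: J_diff J_mult s(1) that)
    then have "r = 0" using r min by fastforce
    then have "s dvd [:c:] * t" using eq by simp
    then show ?thesis using s(2) by (intro exI[of _ c]) (simp add: c_def)
  qed
  \<comment> \<open>So \<open>s\<close> lies in \<open>\<complex>[x]\<close> and is the eliminant.\<close>
  have "degree s = 0"
  proof (rule ccontr)
    assume deg: "degree s \<noteq> 0"
    have "degree p \<noteq> 0" using min[OF \<open>p \<in> J\<close>] deg p by auto
    have no_const: "\<not> p dvd [:c:]" if "c \<noteq> 0" for c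
      using dvd_imp_degree_le[of p "[:c:]"] \<open>degree p \<noteq> 0\<close> that by auto
    obtain c q where c: "c \<noteq> 0" "[:c:] * p = s * q"
      using s_dvd[OF \<open>p \<in> J\<close>] by (auto elim!: dvdE)
    obtain c' where c': "c' \<noteq> 0" "s dvd [:c':] * h"
      using s_dvd[OF \<open>h \<in> J\<close>] by blast
    have "p dvd s * q" using c(2) by (metis dvd_triv_right)
    then consider "p dvd s" | "p dvd q"
      using p by (auto simp: prime_dvd_mult_iff)
    then show False
    proof cases
      case 1
      then have "p dvd [:c':] * h" using c'(2) by (rule dvd_trans)
      then show False using prime_dvd_mult_iff[OF p] h no_const[OF c'(1)] by blast
    next
      case 2
      then obtain k where "q = p * k" by (elim dvdE)
      then have "p * [:c:] = p * (s * k)" using c(2) by (metis mult.commute mult.left_commute)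
      moreover have "p \<noteq> 0" using p by auto
      ultimately have "[:c:] = s * k" using mult_left_cancel by blast
      moreover have "[:c:] \<noteq> 0" using c(1) by simp
      ultimately have "degree s + degree k = 0"
        by (metis degree_mult_eq degree_pCons_0 mult_eq_0_iff)
      then show False using deg by simp
    qed
  qed
  then obtain r where "s = [:r:]" by (rule degree_eq_zeroE)
  then show thesis using that s by (auto simp: J_def)
qed

text \<open>
  Here \<open>[:[:-x, 1:]:]\<close> is the equation of the vertical line over \<open>x\<close>. If it does not divide \<open>q\<close>,
  the restriction of \<open>q\<close> to the line is a nonzero polynomial in one variable.
\<close>

lemma finite_fibre:
  assumes "\<not> [:[:-x, 1:]:] dvd q"
  shows "finite {y. eval2 q (x, y) = 0}"
proof -
  have "map_poly (\<lambda>a. poly a x) q \<noteq> 0"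
    using assms by (auto simp: const_poly_dvd_iff poly_eq_iff coeff_map_poly simp flip: poly_eq_0_iff_dvd)
  then show ?thesis
    using poly_roots_finite by (fastforce simp flip: poly_fibre_eq_eval2)
qed

text \<open>
  The weak form of Bezout's theorem: elimination leaves finitely many values of \<open>x\<close>. A vertical
  line over one of them lies in at most one of the two curves, since otherwise the prime
  polynomial \<open>p\<close> would be a unit times the equation of the line and so divide \<open>h\<close>.
\<close>

lemma finite_common_zeros_prime:
  assumes p: "prime p" and h: "\<not> p dvd h"
  shows "finite (curve p \<inter> curve h)"
proof -
  obtain r a b where r: "r \<noteq> 0" "[:r:] = a * p + b * h"
    using prime_elimination[OF assms] by metis
  define F where "F x = {y. eval2 p (x, y) = 0 \<and> eval2 h (x, y) = 0}" for x
  have "poly r x = 0" if "y \<in> F x" for x y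
    using arg_cong[OF r(2), of "\<lambda>q. eval2 q (x, y)"] that
    by (simp add: eval2_const eval2_add eval2_mult F_def)
  then have "curve p \<inter> curve h \<subseteq> (SIGMA x:{x. poly r x = 0}. F x)"
    by (auto simp: curve_def F_def)
  moreover have "finite (F x)" for x
  proof -
    define l :: "complex poly poly" where "l = [:[:-x, 1:]:]"
    have "\<not> l dvd p \<or> \<not> l dvd h"
    proof (rule ccontr, clarsimp)
      assume "l dvd p" "l dvd h"
      then obtain q where q: "p = l * q" by (elim dvdE)
      then have "p dvd l \<or> p dvd q" using prime_dvd_mult_iff[OF p, of l q] by simp
      moreover have "\<not> p dvd l" using h \<open>l dvd h\<close> dvd_trans by blast
      moreover have "\<not> p dvd q"
      proof
        assume "p dvd q"
        then obtain k where "q = p * k" by (elim dvdE)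
        then have "p * (l * k) = p * 1" using q by (metis mult.commute mult.left_commute mult.right_neutral)
        moreover have "p \<noteq> 0" using p by auto
        ultimately have "l * k = 1" using mult_left_cancel by blast
        then have "l dvd 1" by (metis dvd_triv_left)
        then show False by (simp add: l_def is_unit_const_poly_iff is_unit_iff_degree)
      qed
      ultimately show False by blast
    qed
    then show ?thesis
      using finite_fibre[of x p] finite_fibre[of x h]
      by (auto simp: l_def F_def elim: finite_subset[rotated])
  qed
  ultimately show ?thesis
    using poly_roots_finite[OF r(1)] by (meson finite_SigmaI finite_subset)
qed

text \<open>
  A curve is the union of the curves of its prime factors, so finiteness of a subset can be
  checked on each of them.
\<close>

lemma finite_if_finite_on_components:
  assumes "f \<noteq> 0" "S \<subseteq> curve f" "\<And>p. prime p \<Longrightarrow> p dvd f \<Longrightarrow> finite (S \<inter> curve p)"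
  shows "finite S"
  using assms
proof (induction f arbitrary: S rule: prime_divisors_induct)
  case (unit u)
  then obtain c where "u = [:c:]" "c dvd 1" by (auto simp: is_unit_poly_iff)
  then have "curve u = {}" by (auto simp: curve_def eval2_const is_unit_poly_iff)
  then show ?case using unit by simp
next
  case (factor p q)
  have "finite (S \<inter> curve q)"
  proof (rule factor.IH)
    fix r assume "prime r" "r dvd q"
    then have "finite (S \<inter> curve r)"
      using factor.prems(3) by (simp add: dvd_mult)
    then show "finite (S \<inter> curve q \<inter> curve r)"
      by (rule rev_finite_subset) blast
  qed (use factor.prems(1) in auto)
  moreover have "S = (S \<inter> curve p) \<union> (S \<inter> curve q)"
    using factor.prems(2) by (auto simp: curve_def eval2_mult)
  ultimately show ?case
    using factor.hyps factor.prems(3)[of p] by (metis dvd_triv_left finite_Un)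
qed simp

lemma finite_intersection_of_coprime_curves:
  assumes "coprime f g" "f \<noteq> 0"
  shows "finite (curve f \<inter> curve g)"
proof (rule finite_if_finite_on_components[OF \<open>f \<noteq> 0\<close>])
  fix p assume p: "prime p" "p dvd f"
  then have "\<not> p dvd g"
    using assms(1) by (meson not_coprimeI not_prime_unit)
  then show "finite (curve f \<inter> curve g \<inter> curve p)"
    by (intro finite_subset[OF _ finite_common_zeros_prime[OF p(1)]]) auto
qed auto

text \<open>
  If a prime factor \<open>p\<close> of \<open>f = p q\<close> divided both partial derivatives of \<open>f\<close>, it would divide
  \<open>p\<^sub>x q\<close> and \<open>p\<^sub>y q\<close>, and by squarefreeness \<open>p\<^sub>x\<close> and \<open>p\<^sub>y\<close>; for degree reasons both would vanish
  and \<open>p\<close> would be constant. So on each component one of the derivatives is a polynomial that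
  \<open>p\<close> does not divide.
\<close>

lemma finite_singular_points:
  assumes "squarefree f"
  shows "finite {z. eval2 f z = 0 \<and> eval2 (pderiv_x f) z = 0 \<and> eval2 (pderiv f) z = 0}" (is "finite ?S")
proof (rule finite_if_finite_on_components)
  show "f \<noteq> 0" using assms by auto
  fix p assume p: "prime p" "p dvd f"
  then obtain q where q: "f = p * q" by (elim dvdE)
  have "\<not> p dvd q"
  proof
    assume "p dvd q"
    then have "p ^ 2 dvd f" by (simp add: q power2_eq_square)
    then show False using assms p(1) by (auto simp: squarefree_def)
  qed
  have "\<not> p dvd pderiv_x f \<or> \<not> p dvd pderiv f"
  proof (rule ccontr, clarsimp)
    assume "p dvd pderiv_x f" "p dvd pderiv f"
    then have "p dvd pderiv_x p * q" "p dvd q * pderiv p"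
      by (simp_all add: q pderiv_x_mult pderiv_mult dvd_add_right_iff dvd_add_left_iff)
    then have dvd: "p dvd pderiv_x p" "p dvd pderiv p"
      using \<open>\<not> p dvd q\<close> p(1) by (simp_all add: prime_dvd_mult_iff)
    have "pderiv p = 0"
      using dvd_imp_degree_le[OF dvd(2)] by (cases "degree p") (auto simp: degree_pderiv pderiv_eq_0_iff)
    then obtain a where a: "p = [:a:]" by (auto simp: pderiv_eq_0_iff elim: degree_eq_zeroE)
    then have "a dvd pderiv a"
      using dvd(1) by (simp add: pderiv_x_pCons const_poly_dvd_const_poly_iff)
    then have "pderiv a = 0"
      using dvd_imp_degree_le by (fastforce simp: degree_pderiv pderiv_eq_0_iff)
    then obtain c where "a = [:c:]" by (auto simp: pderiv_eq_0_iff elim: degree_eq_zeroE)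
    then show False using p(1) a by (auto simp: prime_def prime_elem_def is_unit_const_poly_iff dvd_field_iff)
  qed
  then show "finite (?S \<inter> curve p)"
  proof
    assume "\<not> p dvd pderiv_x f"
    from finite_common_zeros_prime[OF p(1) this] show ?thesis
      by (rule finite_subset[rotated]) (auto simp: curve_def)
  next
    assume "\<not> p dvd pderiv f"
    from finite_common_zeros_prime[OF p(1) this] show ?thesis
      by (rule finite_subset[rotated]) (auto simp: curve_def)
  qed
qed (auto simp: curve_def)

text \<open>
  If \<open>f\<close> involves \<open>y\<close>, then over every \<open>x\<close> at which the leading coefficient is nonzero there is a
  root by the fundamental theorem of algebra; otherwise the curve contains a vertical line.
\<close>

lemma infinite_curve:
  assumes "nonconstant f"
  shows "infinite (curve f)"
proof (cases "degree f = 0")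
  case True
  then obtain a where a: "f = [:a:]" by (rule degree_eq_zeroE)
  then have "degree a \<noteq> 0"
    using assms by (metis degree_eq_zeroE nonconstant_def)
  then obtain x where x: "poly a x = 0"
    using Fundamental_Theorem_Algebra.fundamental_theorem_of_algebra[of a] by (auto simp: constant_degree)
  have "range (\<lambda>y. (x, y)) \<subseteq> curve f"
    using x by (auto simp: curve_def a eval2_const)
  moreover have "infinite (range (\<lambda>y::complex. (x, y)))"
    by (subst finite_image_iff) (auto simp: inj_on_def infinite_UNIV_char_0)
  ultimately show ?thesis using finite_subset by blast
next
  case False
  define X where "X = {x. poly (lead_coeff f) x \<noteq> 0}"
  have "\<exists>y. eval2 f (x, y) = 0" if "x \<in> X" for x
  proof -
    define q where "q = map_poly (\<lambda>a. poly a x) f"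
    have "degree q = degree f"
      using that unfolding q_def X_def by (intro map_poly_degree_eq) simp
    then show ?thesis
      using Fundamental_Theorem_Algebra.fundamental_theorem_of_algebra[of q] False by (auto simp: constant_degree q_def poly_fibre_eq_eval2)
  qed
  then have "X \<subseteq> fst ` curve f" by (force simp: curve_def)
  moreover have "infinite X"
  proof -
    have "finite (- X)"
      using poly_roots_finite[of "lead_coeff f"] False by (cases "f = 0") (auto simp: X_def Compl_eq)
    then show ?thesis using infinite_UNIV_char_0[where 'a = complex] by (metis Compl_partition finite_Un)
  qed
  ultimately show ?thesis using finite_imageI infinite_super by metis
qed

section \<open>Logarithmic differentials are closed\<close>

lemma has_derivative_eval2_quotient:
  assumes "eval2 g z \<noteq> 0"
  shows "((\<lambda>z. eval2 q z / eval2 g z) has_derivative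
    (\<lambda>v. eval2 (dir_pderiv v q * g - q * dir_pderiv v g) z / eval2 (g * g) z)) (at z)"
  by (rule has_derivative_eq_rhs[OF has_derivative_divide[OF has_derivative_eval2 has_derivative_eval2 assms]])
     (use assms in \<open>simp add: fun_eq_iff eval2_diff eval2_mult field_simps\<close>)

lemma frechet_derivative_eval2_quotient:
  assumes "eval2 g z \<noteq> 0"
  shows "frechet_derivative (\<lambda>z. eval2 q z / eval2 g z) (at z) v =
    eval2 (dir_pderiv v q * g - q * dir_pderiv v g) z / eval2 (g * g) z"
  by (rule frechet_derivative_at[OF has_derivative_eval2_quotient[OF assms], THEN fun_cong, symmetric])

text \<open>
  The class of quotients of polynomials without poles on \<open>U\<close> is closed under directional
  derivatives, which makes the induction on the order go through.
\<close>

lemma Ck_on_eval2_quotient: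
  assumes "open U" "\<And>z. z \<in> U \<Longrightarrow> eval2 g z \<noteq> 0"
  shows "Ck_on k U (\<lambda>z. eval2 q z / eval2 g z)"
  using assms(2)
proof (induction k arbitrary: q g)
  case 0
  then show ?case by (auto intro!: continuous_intros)
next
  case (Suc k)
  have "Ck_on k U (\<lambda>z. frechet_derivative (\<lambda>z. eval2 q z / eval2 g z) (at z) v)" for v
  proof (rule Ck_on_cong[OF \<open>open U\<close>])
    show "Ck_on k U (\<lambda>z. eval2 (dir_pderiv v q * g - q * dir_pderiv v g) z / eval2 (g * g) z)"
      using Suc.prems by (intro Suc.IH) (simp add: eval2_mult)
  qed (use Suc.prems in \<open>simp add: frechet_derivative_eval2_quotient\<close>)
  moreover have "(\<lambda>z. eval2 q z / eval2 g z) differentiable (at z)" if "z \<in> U" for z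
    using has_derivative_eval2_quotient[OF Suc.prems[OF that]] by (auto simp: differentiable_def)
  ultimately show ?case by simp
qed

lemma dlog_form_eq: "dlog_form f z v = eval2 (dir_pderiv v f) z / eval2 f z"
  by (simp add: dlog_form_def frechet_derivative_eval2)

lemma dir_pderiv_commute: "dir_pderiv u (dir_pderiv v q) = dir_pderiv v (dir_pderiv u q)"
proof -
  have const: "pderiv_x ([:[:c:]:] * r) = [:[:c:]:] * pderiv_x r"
    "pderiv ([:[:c:]:] * r) = [:[:c:]:] * pderiv r" for c and r :: "complex poly poly"
    by (simp_all add: pderiv_x_mult pderiv_x_pCons pderiv_mult pderiv_pCons del: mult_pCons_left)
  show ?thesis
    unfolding dir_pderiv_def
    by (simp add: pderiv_x_add const pderiv_add pderiv_x_pderiv_commute distrib_left del: mult_pCons_left)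
qed

lemma linear_dlog_form: "linear (dlog_form f z)"
  by (rule linearI) (simp_all add: dlog_form_eq eval2_dir_pderiv field_simps add_divide_distrib scaleR_conv_of_real)

lemma closed_dlog_form:
  assumes "open U" "\<And>z. z \<in> U \<Longrightarrow> eval2 f z \<noteq> 0"
  shows "closed_one_form U (dlog_form f)"
  unfolding closed_one_form_def smooth_one_form_def smooth_on_def dlog_form_eq
  using Ck_on_eval2_quotient[OF assms]
  by (auto simp: linear_dlog_form[unfolded dlog_form_eq] frechet_derivative_eval2_quotient assms(2)
      dir_pderiv_commute eval2_diff eval2_mult)

section \<open>Winding numbers of singular chains\<close>

text \<open>
  The common form of the integral and of the winding number of a chain.
\<close>

definition chain_eval :: "('b \<Rightarrow> complex) \<Rightarrow> ('b \<Rightarrow>\<^sub>0 int) \<Rightarrow> complex" where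
  "chain_eval h c = (\<Sum>\<sigma>\<in>Poly_Mapping.keys c. of_int (Poly_Mapping.lookup c \<sigma>) * h \<sigma>)"

lemma chain_eval_superset:
  assumes "finite S" "Poly_Mapping.keys c \<subseteq> S"
  shows "chain_eval h c = (\<Sum>\<sigma>\<in>S. of_int (Poly_Mapping.lookup c \<sigma>) * h \<sigma>)"
  unfolding chain_eval_def using assms by (intro sum.mono_neutral_left) (auto simp: in_keys_iff)

lemma chain_eval_0 [simp]: "chain_eval h 0 = 0"
  by (simp add: chain_eval_def)

lemma chain_eval_frag_of [simp]: "chain_eval h (frag_of \<sigma>) = h \<sigma>"
  by (simp add: chain_eval_def)

lemma chain_eval_add: "chain_eval h (c + d) = chain_eval h c + chain_eval h d"
proof -
  let ?S = "Poly_Mapping.keys c \<union> Poly_Mapping.keys d"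
  have "Poly_Mapping.keys (c + d) \<subseteq> ?S" by (rule Poly_Mapping.keys_add)
  then show ?thesis
    by (simp add: chain_eval_superset[of ?S] lookup_add sum.distrib ring_distribs)
qed

lemma chain_eval_diff: "chain_eval h (c - d) = chain_eval h c - chain_eval h d"
  using chain_eval_add[of h "c - d" d] by simp

lemma chain_integral_eq_chain_eval:
  "chain_integral \<eta> c = chain_eval (\<lambda>\<sigma>. line_integral \<eta> (simplex_path \<sigma>)) c"
  by (simp add: chain_integral_def chain_eval_def)

text \<open>
  Barycentric coordinates, which transfer a singular 2-simplex to a triangle in the normed space
  \<open>\<real> \<times> \<real>\<close>, where the homotopy theory of paths applies.
\<close>

definition triangle_point :: "real \<times> real \<Rightarrow> nat \<Rightarrow> real" where
  "triangle_point ab = (\<lambda>k. if k = 0 then 1 - fst ab - snd ab else if k = 1 then fst ab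
     else if k = 2 then snd ab else 0)"

lemma continuous_on_singular_simplex:
  assumes "singular_simplex p (top_of_set U) \<sigma>" "continuous_on A T" "T ` A \<subseteq> standard_simplex p"
  shows "continuous_on A (\<lambda>x. \<sigma> (T x))" "x \<in> A \<Longrightarrow> \<sigma> (T x) \<in> U"
proof -
  have "continuous_on (standard_simplex p) \<sigma>" "\<sigma> ` standard_simplex p \<subseteq> U"
    using assms(1)
    by (auto simp: singular_simplex_def euclidean_product_topology continuous_map_in_subtopology)
  then show "continuous_on A (\<lambda>x. \<sigma> (T x))" "x \<in> A \<Longrightarrow> \<sigma> (T x) \<in> U"
    using assms(2,3) continuous_on_compose2[of "standard_simplex p" \<sigma> A T] by auto
qed

lemma singular_simplex_1_path:
  assumes "singular_simplex 1 (top_of_set U) \<sigma>"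
  shows "path (simplex_path \<sigma>)" "path_image (simplex_path \<sigma>) \<subseteq> U"
proof -
  define T :: "real \<Rightarrow> nat \<Rightarrow> real" where "T t = (\<lambda>k. if k = 0 then 1 - t else if k = 1 then t else 0)" for t
  have "continuous_on {0..1} T"
  proof (rule continuous_on_coordinatewise_then_product)
    show "continuous_on {0..1} (\<lambda>t. T t k)" for k
      by (cases "k = 0"; cases "k = 1") (simp_all add: T_def continuous_intros)
  qed
  moreover have "T ` {0..1} \<subseteq> standard_simplex 1"
    by (auto simp: T_def standard_simplex_def)
  ultimately show "path (simplex_path \<sigma>)" "path_image (simplex_path \<sigma>) \<subseteq> U"
    using continuous_on_singular_simplex[OF assms, of "{0..1}" T]
    by (auto simp: path_def path_image_def simplex_path_def[abs_def] T_def)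
qed

text \<open>
  Pulled back to the triangle, the edges from vertex 0 to 1 and from 1 to 2 together are homotopic,
  by convexity, to the edge from 0 to 2, and \<open>g\<close> carries the homotopy into \<open>\<complex> - {0}\<close>.
\<close>

lemma winding_number_triangle:
  fixes \<sigma> :: "(nat \<Rightarrow> real) \<Rightarrow> 'a::topological_space"
  assumes \<sigma>: "singular_simplex 2 (top_of_set U) \<sigma>"
    and g: "continuous_on U g" "\<And>z. z \<in> U \<Longrightarrow> g z \<noteq> 0"
  defines "W \<equiv> \<lambda>\<tau>. winding_number (g \<circ> simplex_path \<tau>) 0"
  shows "W (singular_face 2 0 \<sigma>) + W (singular_face 2 2 \<sigma>) = W (singular_face 2 1 \<sigma>)"
proof -
  define K where "K = {ab :: real \<times> real. 0 \<le> fst ab \<and> 0 \<le> snd ab \<and> fst ab + snd ab \<le> 1}"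
  define F where "F = (\<lambda>ab. g (\<sigma> (triangle_point ab)))"
  have "continuous_on K triangle_point"
  proof (rule continuous_on_coordinatewise_then_product)
    show "continuous_on K (\<lambda>ab. triangle_point ab k)" for k
      by (cases "k = 0"; cases "k = 1"; cases "k = 2") (simp_all add: triangle_point_def continuous_intros)
  qed
  moreover have "triangle_point ` K \<subseteq> standard_simplex 2"
    by (auto simp: triangle_point_def K_def standard_simplex_def numeral_2_eq_2)
  ultimately have \<sigma>K: "continuous_on K (\<lambda>ab. \<sigma> (triangle_point ab))" "\<And>ab. ab \<in> K \<Longrightarrow> \<sigma> (triangle_point ab) \<in> U"
    using continuous_on_singular_simplex[OF \<sigma>] by blast+
  have F: "continuous_on K F" "F \<in> K \<rightarrow> - {0}"
    unfolding F_def using continuous_on_compose2[OF g(1) \<sigma>K(1)] \<sigma>K(2) g(2) by blast+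
  have F0: "0 \<noteq> F x" if "x \<in> K" for x
    using F(2) that by (metis ComplD PiE singletonI)
  have "convex K"
  proof (rule convexI)
    fix x y :: "real \<times> real" and u v :: real
    assume *: "x \<in> K" "y \<in> K" "0 \<le> u" "0 \<le> v" "u + v = 1"
    then have "u * (fst x + snd x) + v * (fst y + snd y) \<le> u * 1 + v * 1"
      by (intro add_mono mult_left_mono) (auto simp: K_def)
    with * show "u *\<^sub>R x + v *\<^sub>R y \<in> K"
      by (auto simp: K_def algebra_simps)
  qed
  have vertices: "(0, 0) \<in> K" "(1, 0) \<in> K" "(0, 1) \<in> K"
    by (auto simp: K_def)
  let ?e = "linepath :: real \<times> real \<Rightarrow> _"
  have segs: "path_image (?e a b) \<subseteq> K" if "a \<in> K" "b \<in> K" for a b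
    using that \<open>convex K\<close> by (simp add: closed_segment_subset)
  have pF: "path (F \<circ> ?e a b)" "0 \<notin> path_image (F \<circ> ?e a b)" if "a \<in> K" "b \<in> K" for a b
  proof -
    show "path (F \<circ> ?e a b)"
      using segs[OF that] F(1) by (intro path_continuous_image) (auto intro: continuous_on_subset)
    show "0 \<notin> path_image (F \<circ> ?e a b)"
      using segs[OF that] F0 by (auto simp only: path_image_compose image_iff)
  qed
  have hom: "homotopic_paths K (?e (0,0) (1,0) +++ ?e (1,0) (0,1)) (?e (0,0) (0,1))"
  proof (rule homotopic_paths_linear)
    fix t :: real assume t: "t \<in> {0..1}"
    have "path_image (?e (0,0) (1,0) +++ ?e (1,0) (0,1)) \<subseteq> K"
      using segs vertices by (intro subset_path_image_join) auto
    then show "closed_segment ((?e (0,0) (1,0) +++ ?e (1,0) (0,1)) t) (?e (0,0) (0,1) t) \<subseteq> K"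
      using t segs[OF vertices(1,3)] \<open>convex K\<close>
      by (intro closed_segment_subset) (auto simp: path_image_def)
  qed auto
  have "winding_number (F \<circ> ?e (0,0) (0,1)) 0 = winding_number (F \<circ> (?e (0,0) (1,0) +++ ?e (1,0) (0,1))) 0"
    using homotopic_paths_continuous_image[OF hom F]
    by (intro winding_number_homotopic_paths) (simp add: homotopic_paths_sym)
  also have "\<dots> = winding_number (F \<circ> ?e (0,0) (1,0)) 0 + winding_number (F \<circ> ?e (1,0) (0,1)) 0"
    unfolding path_compose_join
    using pF vertices by (intro winding_number_join) (auto simp: pathstart_compose pathfinish_compose)
  finally have *: "winding_number (F \<circ> ?e (0,0) (0,1)) 0
    = winding_number (F \<circ> ?e (0,0) (1,0)) 0 + winding_number (F \<circ> ?e (1,0) (0,1)) 0" .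
  have pt: "triangle_point (t, 0) \<in> standard_simplex 1" if "0 \<le> t" "t \<le> 1" for t
    using that by (auto simp: triangle_point_def standard_simplex_def)
  \<comment> \<open>\<open>triangle_point (t, 0)\<close> also parametrizes the standard 1-simplex, as its third coordinate is 0.\<close>
  have face_path: "simplex_path (singular_face 2 k \<sigma>) t = \<sigma> (simplical_face k (triangle_point (t, 0)))"
    if "0 \<le> t" "t \<le> 1" for k t
  proof -
    have "(\<lambda>k. if k = 0 then 1 - t else if k = 1 then t else 0) = triangle_point (t, 0)"
      by (auto simp: triangle_point_def)
    then show ?thesis
      using pt[OF that] by (simp add: simplex_path_def singular_face_def)
  qed
  have faces:
    "simplical_face 0 (triangle_point (t, 0)) = triangle_point (?e (1,0) (0,1) t)"
    "simplical_face 1 (triangle_point (t, 0)) = triangle_point (?e (0,0) (0,1) t)"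
    "simplical_face 2 (triangle_point (t, 0)) = triangle_point (?e (0,0) (1,0) t)" for t
  proof -
    have "simplical_face 0 (triangle_point (t, 0)) i = triangle_point (?e (1,0) (0,1) t) i"
      "simplical_face 1 (triangle_point (t, 0)) i = triangle_point (?e (0,0) (0,1) t) i"
      "simplical_face 2 (triangle_point (t, 0)) i = triangle_point (?e (0,0) (1,0) t) i" for i
      by (auto simp: simplical_face_def triangle_point_def linepath_def)
    then show "simplical_face 0 (triangle_point (t, 0)) = triangle_point (?e (1,0) (0,1) t)"
      "simplical_face 1 (triangle_point (t, 0)) = triangle_point (?e (0,0) (0,1) t)"
      "simplical_face 2 (triangle_point (t, 0)) = triangle_point (?e (0,0) (1,0) t)"
      by blast+
  qed
  have W: "W (singular_face 2 k \<sigma>) = winding_number (F \<circ> p) 0"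
    if "\<And>t. simplical_face k (triangle_point (t, 0)) = triangle_point (p t)" for k p
    unfolding W_def by (intro winding_number_cong) (simp add: face_path that F_def)
  have "W (singular_face 2 0 \<sigma>) = winding_number (F \<circ> ?e (1,0) (0,1)) 0"
    "W (singular_face 2 1 \<sigma>) = winding_number (F \<circ> ?e (0,0) (0,1)) 0"
    "W (singular_face 2 2 \<sigma>) = winding_number (F \<circ> ?e (0,0) (1,0)) 0"
    by (intro W faces)+
  then show ?thesis using * by simp
qed

lemma winding_number_boundary:
  fixes d :: "'a::topological_space chain"
  assumes d: "singular_chain 2 (top_of_set U) d"
    and g: "continuous_on U g" "\<And>z. z \<in> U \<Longrightarrow> g z \<noteq> 0"
  shows "chain_eval (\<lambda>\<tau>. winding_number (g \<circ> simplex_path \<tau>) 0) (chain_boundary 2 d) = 0"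
  using d unfolding singular_chain_def
proof (induction d rule: frag_induction)
  case (one \<sigma>)
  have "chain_boundary 2 (frag_of \<sigma>) = frag_of (singular_face 2 0 \<sigma>) - frag_of (singular_face 2 1 \<sigma>)
      + frag_of (singular_face 2 2 \<sigma>)"
    by (simp add: chain_boundary_of numeral_2_eq_2)
  moreover have "winding_number (g \<circ> simplex_path (singular_face 2 0 \<sigma>)) 0
      + winding_number (g \<circ> simplex_path (singular_face 2 2 \<sigma>)) 0
      = winding_number (g \<circ> simplex_path (singular_face 2 1 \<sigma>)) 0"
    using one by (intro winding_number_triangle[OF _ g]) simp
  ultimately show ?case
    by (simp only: chain_eval_add chain_eval_diff chain_eval_frag_of) (simp add: algebra_simps)
qed (auto simp: chain_boundary_diff chain_eval_diff)

section \<open>Logarithmic integrals along paths and homology classes\<close>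

text \<open>
  Paths that agree on the unit interval may differ outside it, hence in their two-sided derivatives
  at \<open>0\<close> and \<open>1\<close>; these two points join the finite exceptional set.
\<close>

lemma valid_path_cong:
  assumes "valid_path p" "\<And>t. t \<in> {0..1} \<Longrightarrow> q t = p t"
  shows "valid_path q"
proof -
  obtain S D where S: "finite S" "continuous_on ({0..1} - S) D"
    "\<And>t. t \<in> {0..1} - S \<Longrightarrow> (p has_vector_derivative D t) (at t)"
    and "continuous_on {0..1} p"
    using assms(1) unfolding valid_path_def piecewise_C1_differentiable_on_def C1_differentiable_on_def
    by blast
  have "(q has_vector_derivative D t) (at t)" if "t \<in> {0..1} - (S \<union> {0, 1})" for t
  proof -
    have t: "t \<in> {0<..<1}" using that by auto
    have "(p has_vector_derivative D t) (at t)" using that by (intro S(3)) auto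
    then show ?thesis
      by (rule has_vector_derivative_transform_within_open[where S = "{0<..<1}"]) (use t assms(2) in auto)
  qed
  moreover have "continuous_on ({0..1} - (S \<union> {0, 1})) D"
    using S(2) by (rule continuous_on_subset) auto
  moreover have "continuous_on {0..1} q"
    using \<open>continuous_on {0..1} p\<close> assms(2) continuous_on_cong[OF refl, of "{0..1}" q p] by simp
  ultimately show ?thesis
    unfolding valid_path_def piecewise_C1_differentiable_on_def C1_differentiable_on_def
    using S(1) by (intro conjI exI[of _ "S \<union> {0, 1}"] exI[of _ D] ballI) simp_all
qed

lemma has_vector_derivative_eval2:
  assumes "(\<gamma> has_vector_derivative d) (at t)"
  shows "((\<lambda>t. eval2 f (\<gamma> t)) has_vector_derivative eval2 (dir_pderiv d f) (\<gamma> t)) (at t)"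
proof -
  have "((\<lambda>t. eval2 f (\<gamma> t)) has_derivative (\<lambda>x. eval2 (dir_pderiv (x *\<^sub>R d) f) (\<gamma> t))) (at t)"
    using assms has_derivative_eval2 unfolding has_vector_derivative_def by (rule has_derivative_compose)
  moreover have "eval2 (dir_pderiv (x *\<^sub>R d) f) z = x *\<^sub>R eval2 (dir_pderiv d f) z" for x z
    by (simp add: eval2_dir_pderiv scaleR_conv_of_real algebra_simps)
  ultimately show ?thesis
    by (simp add: has_vector_derivative_def)
qed

text \<open>
  The change of variables \<open>w = f (\<gamma> t)\<close> turns the integral into the contour integral of
  \<open>1 / w\<close> along \<open>f \<circ> \<gamma>\<close>.
\<close>

lemma has_integral_dlog_form:
  assumes \<gamma>: "valid_path \<gamma>" and f: "\<And>t. t \<in> {0..1} \<Longrightarrow> eval2 f (\<gamma> t) \<noteq> 0"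
  shows "((\<lambda>t. dlog_form f (\<gamma> t) (vector_derivative \<gamma> (at t within {0..1})))
    has_integral 2 * of_real pi * \<i> * winding_number (eval2 f \<circ> \<gamma>) 0) {0..1}"
proof -
  let ?g = "eval2 f \<circ> \<gamma>"
  obtain S D where S: "finite S" "continuous_on ({0..1} - S) D" "continuous_on {0..1} \<gamma>"
    "\<And>t. t \<in> {0..1} - S \<Longrightarrow> (\<gamma> has_vector_derivative D t) (at t)"
    using \<gamma> unfolding valid_path_def piecewise_C1_differentiable_on_def C1_differentiable_on_def
    by blast
  have g': "(?g has_vector_derivative eval2 (dir_pderiv (D t) f) (\<gamma> t)) (at t)"
    if "t \<in> {0..1} - S" for t
    using has_vector_derivative_eval2[OF S(4)[OF that]] by (simp add: o_def)
  have "continuous_on ({0..1} - S) (\<lambda>t. eval2 (dir_pderiv (D t) f) (\<gamma> t))"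
    unfolding eval2_dir_pderiv using S(2) continuous_on_subset[OF S(3)]
    by (intro continuous_intros) auto
  moreover have "continuous_on {0..1} ?g"
    unfolding o_def using S(3) by (rule continuous_on_eval2)
  ultimately have vp: "valid_path ?g"
    unfolding valid_path_def piecewise_C1_differentiable_on_def C1_differentiable_on_def
    using S(1) g' by (intro conjI exI[of _ S] exI[of _ "\<lambda>t. eval2 (dir_pderiv (D t) f) (\<gamma> t)"] ballI)
  have "0 \<notin> path_image ?g" using f by (auto simp: path_image_def)
  then have "((\<lambda>t. 1 / (?g t - 0) * vector_derivative ?g (at t))
      has_integral 2 * of_real pi * \<i> * winding_number ?g 0) {0..1}"
    using has_contour_integral_winding_number[OF vp, of 0] by (simp add: has_contour_integral)
  then show ?thesis
  proof (rule has_integral_spike_finite[OF S(1), rotated])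
    fix t assume t: "t \<in> {0..1} - S"
    have "vector_derivative \<gamma> (at t within {0..1}) = D t"
      using t by (intro vector_derivative_at_within_ivl S(4)) auto
    moreover have "vector_derivative ?g (at t) = eval2 (dir_pderiv (D t) f) (\<gamma> t)"
      using g'[OF t] by (rule vector_derivative_at)
    ultimately show "dlog_form f (\<gamma> t) (vector_derivative \<gamma> (at t within {0..1}))
        = 1 / (?g t - 0) * vector_derivative ?g (at t)"
      by (simp add: dlog_form_eq)
  qed
qed

lemma line_integral_dlog_form:
  assumes "valid_path \<gamma>" "\<And>t. t \<in> {0..1} \<Longrightarrow> eval2 f (\<gamma> t) \<noteq> 0"
  shows "line_integral (dlog_form f) \<gamma> = 2 * of_real pi * \<i> * winding_number (eval2 f \<circ> \<gamma>) 0"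
  unfolding line_integral_def by (rule integral_unique[OF has_integral_dlog_form[OF assms]])

text \<open>
  All piecewise \<open>C\<^sup>1\<close> cycles in the class give the same value since winding numbers vanish on
  boundaries; \<open>\<gamma>\<close> itself is one of them, so the definite description has exactly one solution.
\<close>

lemma class_integral_dlog_form:
  assumes \<gamma>: "valid_path \<gamma>" "path_image \<gamma> \<subseteq> U" and f: "\<And>z. z \<in> U \<Longrightarrow> eval2 f z \<noteq> 0"
  shows "class_integral (dlog_form f) (loop_class U \<gamma>)
    = 2 * of_real pi * \<i> * winding_number (eval2 f \<circ> \<gamma>) 0"
proof -
  let ?X = "top_of_set U" and ?c = "frag_of (path_simplex \<gamma>)"
  let ?W = "\<lambda>\<tau>. winding_number (eval2 f \<circ> simplex_path \<tau>) 0"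
  have contf: "continuous_on U (eval2 f)"
    using continuous_on_eval2[of U "\<lambda>z. z" f] by simp
  have integral_eq: "chain_integral (dlog_form f) c = 2 * of_real pi * \<i> * chain_eval ?W c"
    if c: "singular_chain 1 ?X c" "piecewise_C1_chain c" for c
  proof -
    have "line_integral (dlog_form f) (simplex_path \<sigma>) = 2 * of_real pi * \<i> * ?W \<sigma>"
      if "\<sigma> \<in> Poly_Mapping.keys c" for \<sigma>
    proof (rule line_integral_dlog_form)
      show "valid_path (simplex_path \<sigma>)"
        using c(2) that by (simp add: piecewise_C1_chain_def)
      have "singular_simplex 1 ?X \<sigma>" using c(1) that by (auto simp: singular_chain_def)
      then show "eval2 f (simplex_path \<sigma> t) \<noteq> 0" if "t \<in> {0..1}" for t
        using singular_simplex_1_path(2) that by (intro f) (fastforce simp: path_image_def)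
    qed
    then show ?thesis
      by (simp add: chain_integral_eq_chain_eval chain_eval_def sum_distrib_left algebra_simps)
  qed
  have simplex: "singular_simplex 1 ?X (path_simplex \<gamma>)"
  proof -
    let ?T = "subtopology (powertop_real UNIV) (standard_simplex 1)"
    have 1: "continuous_map ?T (top_of_set {0..1}) (\<lambda>s. s 1)"
      by (auto simp: continuous_map_in_subtopology standard_simplex_def
          intro!: continuous_map_from_subtopology continuous_map_product_projection)
    have 2: "continuous_map (top_of_set {0..1}) ?X \<gamma>"
      using \<gamma> valid_path_imp_path[OF \<gamma>(1)] by (auto simp: path_def path_image_def)
    show ?thesis
      using continuous_map_compose[OF 1 2]
      by (auto simp: singular_simplex_def path_simplex_def o_def intro: continuous_map_eq)
  qed
  have W\<gamma>: "?W (path_simplex \<gamma>) = winding_number (eval2 f \<circ> \<gamma>) 0"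
    by (intro winding_number_cong) (simp add: simplex_path_path_simplex)
  have "chain_integral (dlog_form f) c = 2 * of_real pi * \<i> * winding_number (eval2 f \<circ> \<gamma>) 0"
    if "c \<in> loop_class U \<gamma>" "piecewise_C1_chain c" for c
  proof -
    have "singular_relboundary 1 ?X {} (?c - c)"
      using that(1) by (simp add: loop_class_def homologous_rel_def)
    then obtain d where d: "singular_chain 2 ?X d" "chain_boundary 2 d = ?c - c"
      unfolding singular_boundary by (auto simp: numeral_2_eq_2)
    have "c = ?c - chain_boundary 2 d" using d(2) by simp
    moreover have "singular_chain 1 ?X (chain_boundary 2 d)"
      using singular_chain_boundary[OF d(1)] by simp
    ultimately have "singular_chain 1 ?X c"
      using simplex by (metis singular_chain_diff singular_chain_of)
    moreover have "chain_eval ?W c = ?W (path_simplex \<gamma>)"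
      using winding_number_boundary[OF d(1) contf f] d(2) by (simp add: chain_eval_diff)
    ultimately show ?thesis
      using integral_eq[OF _ that(2)] W\<gamma> by simp
  qed
  moreover have "?c \<in> loop_class U \<gamma>" by (simp add: loop_class_def)
  moreover have "piecewise_C1_chain ?c"
    using valid_path_cong[OF \<gamma>(1), of "simplex_path (path_simplex \<gamma>)"]
    by (simp add: piecewise_C1_chain_def simplex_path_path_simplex)
  ultimately show ?thesis
    unfolding class_integral_def by (intro the_equality) auto
qed

lemma has_integral_differential:
  fixes g :: "'a::euclidean_space \<Rightarrow> complex"
  assumes \<gamma>: "valid_path \<gamma>" and g: "\<And>t. t \<in> {0..1} \<Longrightarrow> g differentiable (at (\<gamma> t))"
  shows "((\<lambda>t. frechet_derivative g (at (\<gamma> t)) (vector_derivative \<gamma> (at t within {0..1})))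
    has_integral g (\<gamma> 1) - g (\<gamma> 0)) {0..1}"
proof -
  obtain S D where S: "finite S" "continuous_on {0..1} \<gamma>"
    "\<And>t. t \<in> {0..1} - S \<Longrightarrow> (\<gamma> has_vector_derivative D t) (at t)"
    using \<gamma> unfolding valid_path_def piecewise_C1_differentiable_on_def C1_differentiable_on_def
    by blast
  have "continuous_on (\<gamma> ` {0..1}) g"
    using g by (intro continuous_at_imp_continuous_on) (auto intro: differentiable_imp_continuous_within)
  then have "continuous_on {0..1} (\<lambda>t. g (\<gamma> t))"
    using S(2) by (rule continuous_on_compose2) auto
  moreover have "((\<lambda>t. g (\<gamma> t)) has_vector_derivative
      frechet_derivative g (at (\<gamma> t)) (vector_derivative \<gamma> (at t within {0..1}))) (at t)"
    if "t \<in> {0<..<1} - S" for t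
  proof -
    have t: "t \<in> {0..1} - S" using that by auto
    then have g': "(g has_derivative frechet_derivative g (at (\<gamma> t))) (at (\<gamma> t))"
      using g by (simp add: frechet_derivative_works)
    have "((\<lambda>t. g (\<gamma> t)) has_derivative (\<lambda>x. frechet_derivative g (at (\<gamma> t)) (x *\<^sub>R D t))) (at t)"
      using S(3)[OF t] g' unfolding has_vector_derivative_def by (rule has_derivative_compose)
    moreover have "vector_derivative \<gamma> (at t within {0..1}) = D t"
      using t by (intro vector_derivative_at_within_ivl S(3)) auto
    ultimately show ?thesis
      using linear_cmul[OF has_derivative_linear[OF g']] by (simp add: has_vector_derivative_def)
  qed
  ultimately show ?thesis
    by (intro fundamental_theorem_of_calculus_interior_strong[OF S(1)]) simp_all
qed

section \<open>Winding numbers around zeros\<close>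

text \<open>
  On the disc \<open>u = exp g\<close> with \<open>g\<close> continuous, so \<open>h\<close> on the circle has an explicit continuous
  logarithm; going around once, \<open>g\<close> returns to its value and \<open>m ln (w - a)\<close> grows by \<open>2 \<pi> \<i> m\<close>.
\<close>

lemma winding_number_power_times_nonzero:
  fixes h u :: "complex \<Rightarrow> complex"
  assumes "r > 0" and u: "continuous_on (cball a r) u" "\<And>w. w \<in> cball a r \<Longrightarrow> u w \<noteq> 0"
    and h: "\<And>w. w \<in> sphere a r \<Longrightarrow> h w = (w - a) ^ m * u w"
  shows "winding_number (h \<circ> circlepath a r) 0 = of_nat m"
proof -
  obtain g where g: "continuous_on (cball a r) g" "\<And>w. w \<in> cball a r \<Longrightarrow> u w = exp (g w)"
    using continuous_logarithm_on_cball[OF u] by blast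
  have circ: "circlepath a r t \<in> sphere a r" for t
    using \<open>r > 0\<close> by (simp add: circlepath dist_norm norm_mult)
  define q where "q t = of_nat m * (of_real (ln r) + 2 * of_real pi * \<i> * of_real t) + g (circlepath a r t)" for t
  have "continuous_on {0..1} (circlepath a r)"
    using path_circlepath by (simp add: path_def)
  then have "path q"
    unfolding path_def q_def using circ sphere_cball
    by (intro continuous_intros continuous_on_compose2[OF g(1)]) blast+
  moreover have "(h \<circ> circlepath a r) t = (exp \<circ> q) t" for t
  proof -
    have "exp (of_nat m * (of_real (ln r) + 2 * of_real pi * \<i> * of_real t)) = (circlepath a r t - a) ^ m"
      using \<open>r > 0\<close> by (simp add: exp_of_nat_mult exp_add circlepath exp_of_real)
    then show ?thesis
      using h[OF circ] g(2) circ sphere_cball by (simp add: q_def exp_add subset_iff)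
  qed
  then have "h \<circ> circlepath a r = exp \<circ> q" by blast
  moreover have "pathfinish q - pathstart q = of_nat m * (2 * of_real pi * \<i>)"
    by (simp add: pathfinish_def pathstart_def q_def circlepath algebra_simps)
  ultimately show ?thesis
    by (simp add: winding_number_compose_exp)
qed

lemma winding_number_nonzero:
  assumes "r > 0" "continuous_on (cball a r) h" "\<And>w. w \<in> cball a r \<Longrightarrow> h w \<noteq> 0"
  shows "winding_number (h \<circ> circlepath a r) 0 = 0"
  using winding_number_power_times_nonzero[OF assms, of h 0] by simp

text \<open>
  Differentiability at the single point \<open>a\<close> already makes \<open>h w / (w - a)\<close> continuous and nonzero on
  the whole disc.
\<close>

lemma winding_number_simple_zero:
  fixes h :: "complex \<Rightarrow> complex"
  assumes r: "r > 0" and h: "continuous_on (cball a r) h" "\<And>w. w \<in> cball a r \<Longrightarrow> h w = 0 \<longleftrightarrow> w = a"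
    and d: "(h has_field_derivative d) (at a)" "d \<noteq> 0"
  shows "winding_number (h \<circ> circlepath a r) 0 = 1"
proof -
  define u where "u w = (if w = a then d else h w / (w - a))" for w
  have "h a = 0" using h(2)[of a] r by simp
  have "continuous (at w within cball a r) u" if "w \<in> cball a r" for w
  proof (cases "w = a")
    case True
    have "((\<lambda>w. (h w - h a) / (w - a)) \<longlongrightarrow> d) (at a within cball a r)"
      using d(1) unfolding has_field_derivative_iff by (rule tendsto_within_subset) simp
    then have "(u \<longlongrightarrow> d) (at a within cball a r)"
      by (rule Lim_transform_eventually) (auto simp: u_def eventually_at_filter \<open>h a = 0\<close>)
    then show ?thesis using True by (simp add: continuous_within u_def)
  next
    case False
    have "continuous (at w within cball a r) (\<lambda>w. h w / (w - a))"
      using h(1) that False by (intro continuous_intros) (auto simp: continuous_on_eq_continuous_within)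
    then have "((\<lambda>w. h w / (w - a)) \<longlongrightarrow> u w) (at w within cball a r)"
      using False by (simp add: continuous_within u_def)
    moreover have "\<forall>\<^sub>F v in at w within cball a r. h v / (v - a) = u v"
      using t1_space_nhds[OF False] unfolding eventually_at_filter
      by (rule eventually_mono) (simp add: u_def)
    ultimately show ?thesis
      unfolding continuous_within by (rule Lim_transform_eventually)
  qed
  then have "continuous_on (cball a r) u"
    by (simp add: continuous_on_eq_continuous_within)
  moreover have "u w \<noteq> 0" if "w \<in> cball a r" for w
    using h(2)[OF that] d(2) by (simp add: u_def)
  moreover have "h w = (w - a) ^ 1 * u w" for w
    by (simp add: u_def \<open>h a = 0\<close>)
  ultimately show ?thesis
    using winding_number_power_times_nonzero[OF r, of a u h 1] by simp
qed

lemma valid_path_holomorphic_curve: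
  assumes "open V" "cball a r \<subseteq> V" "r > 0"
    and "(\<lambda>w. fst (\<psi> w)) holomorphic_on V" "(\<lambda>w. snd (\<psi> w)) holomorphic_on V"
  shows "valid_path (\<lambda>t. \<psi> (circlepath a r t) :: complex \<times> complex)"
proof -
  have circ: "circlepath a r t \<in> V" for t
    using assms(2,3) by (force simp: circlepath dist_norm norm_mult)
  define c' where "c' t = 2 * of_real pi * \<i> * of_real r * exp (2 * of_real pi * \<i> * of_real t)" for t :: real
  have diff: "((\<lambda>t. g (circlepath a r t)) has_vector_derivative c' t * deriv g (circlepath a r t)) (at t)"
    if "g holomorphic_on V" for g t
    using field_vector_diff_chain_at[OF has_vector_derivative_circlepath holomorphic_derivI[OF that \<open>open V\<close> circ]]
    by (simp add: o_def c'_def)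
  have cont: "continuous_on {0..1} (\<lambda>t. c' t * deriv g (circlepath a r t))" if "g holomorphic_on V" for g
  proof (intro continuous_intros)
    show "continuous_on {0..1} c'" unfolding c'_def by (intro continuous_intros)
    have "continuous_on V (deriv g)"
      using holomorphic_deriv[OF that \<open>open V\<close>] by (rule holomorphic_on_imp_continuous_on)
    moreover have "continuous_on {0..1} (circlepath a r)"
      using path_circlepath by (simp add: path_def)
    ultimately show "continuous_on {0..1} (\<lambda>t. deriv g (circlepath a r t))"
      by (rule continuous_on_compose2) (use circ in auto)
  qed
  define D where "D t = (c' t * deriv (\<lambda>w. fst (\<psi> w)) (circlepath a r t),
    c' t * deriv (\<lambda>w. snd (\<psi> w)) (circlepath a r t))" for t
  have "((\<lambda>t. \<psi> (circlepath a r t)) has_vector_derivative D t) (at t)" for t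
    using has_vector_derivative_Pair[OF diff[OF assms(4)] diff[OF assms(5)], of t] by (simp add: D_def)
  moreover have "continuous_on {0..1} D"
    unfolding D_def using cont assms(4,5) by (intro continuous_on_Pair) auto
  ultimately have "(\<lambda>t. \<psi> (circlepath a r t)) C1_differentiable_on {0..1}"
    unfolding C1_differentiable_on_def by blast
  then show ?thesis
    unfolding valid_path_def by (rule C1_differentiable_imp_piecewise)
qed

section \<open>Meridians\<close>

lemma cscale_linear_fst_snd:
  assumes "linear D" "\<And>c v. D (cscale c v) = cscale c (D v)"
  shows "D (a, b) = cscale a (D (1, 0)) + cscale b (D (0, 1))"
proof -
  have "(a, b) = cscale a (1, 0) + cscale b (0, 1)" by (simp add: cscale_def)
  then show ?thesis using assms(2) linear_add[OF assms(1)] by metis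
qed

lemma holomorphic2_slice:
  fixes b :: complex
  assumes "holomorphic2_on \<psi> V" "open V"
  defines "V0 \<equiv> {w. (w, b) \<in> V}"
  shows "open V0" "(\<lambda>w. fst (\<psi> (w, b))) holomorphic_on V0" "(\<lambda>w. snd (\<psi> (w, b))) holomorphic_on V0"
proof -
  have "V0 = (\<lambda>w. (w, b)) -` V" by (auto simp: V0_def)
  then show "open V0" using assms(2) by (simp add: open_vimage continuous_intros)
  have der: "((\<lambda>w. fst (\<psi> (w, b))) has_field_derivative fst (D (1, 0))) (at w) \<and>
      ((\<lambda>w. snd (\<psi> (w, b))) has_field_derivative snd (D (1, 0))) (at w)"
    if D: "(\<psi> has_derivative D) (at (w, b))" "\<And>c v. D (cscale c v) = cscale c (D v)" for w D
  proof -
    have "((\<lambda>w. (w, b)) has_derivative (\<lambda>h. (h, 0))) (at w)"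
      by (auto intro!: derivative_eq_intros)
    from has_derivative_compose[OF this D(1)]
    have "((\<lambda>w. \<psi> (w, b)) has_derivative (\<lambda>h. D (h, 0))) (at w)" .
    moreover have "(\<lambda>h. D (h, 0)) = (\<lambda>h. cscale h (D (1, 0)))"
    proof
      fix h
      have "(h, 0) = cscale h (1, 0)" by (simp add: cscale_def)
      then show "D (h, 0) = cscale h (D (1, 0))" using D(2) by metis
    qed
    ultimately have "((\<lambda>w. \<psi> (w, b)) has_derivative (\<lambda>h. cscale h (D (1, 0)))) (at w)"
      by (simp only:)
    from has_derivative_fst[OF this] has_derivative_snd[OF this] show ?thesis
      by (auto intro!: has_derivative_imp_has_field_derivative simp: cscale_def)
  qed
  have "\<exists>c d. ((\<lambda>w. fst (\<psi> (w, b))) has_field_derivative c) (at w) \<and>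
      ((\<lambda>w. snd (\<psi> (w, b))) has_field_derivative d) (at w)" if "w \<in> V0" for w
  proof -
    have "(w, b) \<in> V" using that by (simp add: V0_def)
    then obtain D where "(\<psi> has_derivative D) (at (w, b))" "\<forall>c v. D (cscale c v) = cscale c (D v)"
      using assms(1) unfolding holomorphic2_on_def by blast
    from der[OF this(1)] this(2) show ?thesis by blast
  qed
  then show "(\<lambda>w. fst (\<psi> (w, b))) holomorphic_on V0" "(\<lambda>w. snd (\<psi> (w, b))) holomorphic_on V0"
    unfolding holomorphic_on_open[OF \<open>open V0\<close>] by blast+
qed

lemma holomorphic2_imp_continuous_on:
  assumes "holomorphic2_on \<psi> V"
  shows "continuous_on V \<psi>"
  using assms unfolding holomorphic2_on_def
  by (intro continuous_at_imp_continuous_on) (blast intro: has_derivative_continuous)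

text \<open>
  In the coordinates the differential of \<open>f\<close> at \<open>(0, s)\<close> is still nonzero, because the differential
  \<open>E\<close> of the inverse chart is surjective. It vanishes in the direction \<open>(0, 1)\<close> along the curve, so
  by complex linearity it cannot vanish in the transverse direction \<open>(1, 0)\<close>.
\<close>

lemma nonsingular_slice_derivative:
  assumes \<phi>: "local_coordinates U \<phi> p"
    and flat: "\<And>z. z \<in> \<phi> ` U \<Longrightarrow> fst z = 0 \<Longrightarrow> eval2 f (inv_into U \<phi> z) = 0"
    and q: "(0, s) \<in> \<phi> ` U"
    and nonsing: "eval2 (pderiv_x f) (inv_into U \<phi> (0, s)) \<noteq> 0 \<or> eval2 (pderiv f) (inv_into U \<phi> (0, s)) \<noteq> 0"
  obtains d where "d \<noteq> 0" "((\<lambda>w. eval2 f (inv_into U \<phi> (w, s))) has_field_derivative d) (at 0)"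
proof -
  define \<psi> where "\<psi> = inv_into U \<phi>"
  define q where "q = \<psi> (0, s)"
  have U: "open U" "inj_on \<phi> U" "open (\<phi> ` U)" "holomorphic2_on \<phi> U" "holomorphic2_on \<psi> (\<phi> ` U)"
    using \<phi> by (auto simp: local_coordinates_def \<psi>_def)
  have "q \<in> U" "\<phi> q = (0, s)"
    using q by (auto simp: q_def \<psi>_def inv_into_into f_inv_into_f)
  obtain E where E: "(\<psi> has_derivative E) (at (0, s))" "\<And>c v. E (cscale c v) = cscale c (E v)"
    using U(5) q by (auto simp: holomorphic2_on_def)
  obtain D where D: "(\<phi> has_derivative D) (at q)"
    using U(4) \<open>q \<in> U\<close> by (auto simp: holomorphic2_on_def)
  have surj: "E (D v) = v" for v
  proof -
    have "(\<psi> has_derivative E) (at (\<phi> q))" using E(1) \<open>\<phi> q = (0, s)\<close> by simp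
    from has_derivative_compose[OF D this]
    have "((\<lambda>x. x) has_derivative (\<lambda>v. E (D v))) (at q)"
      by (rule has_derivative_transform_within_open[OF _ U(1) \<open>q \<in> U\<close>]) (simp add: \<psi>_def U(2))
    then have "(\<lambda>v. E (D v)) = (\<lambda>v. v)"
      using has_derivative_ident has_derivative_unique by blast
    then show ?thesis by (rule fun_cong)
  qed
  define L where "L v = eval2 (dir_pderiv (E v) f) q" for v
  have L: "((\<lambda>z. eval2 f (\<psi> z)) has_derivative L) (at (0, s))"
    unfolding L_def q_def using E(1) has_derivative_eval2 by (rule has_derivative_compose)
  have L_cscale: "L (a, b) = a * L (1, 0) + b * L (0, 1)" for a b
    using cscale_linear_fst_snd[OF has_derivative_linear[OF E(1)] E(2), of a b]
    by (simp add: L_def eval2_dir_pderiv cscale_def algebra_simps)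
  have L1: "((\<lambda>w. eval2 f (\<psi> (w, s))) has_field_derivative L (1, 0)) (at 0)"
  proof -
    have "((\<lambda>w. (w, s)) has_derivative (\<lambda>h. (h, 0))) (at 0)"
      by (auto intro!: derivative_eq_intros)
    from has_derivative_compose[OF this L]
    have "((\<lambda>w. eval2 f (\<psi> (w, s))) has_derivative (\<lambda>h. L (h, 0))) (at 0)" .
    moreover have "(\<lambda>h. L (h, 0)) = (*) (L (1, 0))"
      by (rule ext) (subst L_cscale, simp)
    ultimately show ?thesis
      by (simp only: has_field_derivative_def)
  qed
  have "L (0, 1) = 0"
  proof -
    have "((\<lambda>w. (0, w)) has_derivative (\<lambda>h. (0, h))) (at s)"
      by (auto intro!: derivative_eq_intros)
    from has_derivative_compose[OF this L]
    have "((\<lambda>w. eval2 f (\<psi> (0, w))) has_derivative (\<lambda>h. L (0, h))) (at s)" .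
    moreover have "open ((\<lambda>w. (0, w)) -` (\<phi> ` U))"
      using U(3) by (intro open_vimage continuous_intros)
    ultimately have "((\<lambda>w. 0) has_derivative (\<lambda>h. L (0, h))) (at s)"
      by (rule has_derivative_transform_within_open) (use q flat in \<open>auto simp: \<psi>_def\<close>)
    then have "(\<lambda>h. L (0, h)) = (\<lambda>h. 0)"
      using has_derivative_const has_derivative_unique by blast
    then show ?thesis by (rule fun_cong)
  qed
  have "L (1, 0) \<noteq> 0"
  proof
    assume "L (1, 0) = 0"
    then have "L v = 0" for v
      using L_cscale[of "fst v" "snd v"] \<open>L (0, 1) = 0\<close> by (simp only: prod.collapse mult_zero_right add_0)
    then have "eval2 (dir_pderiv v f) q = 0" for v
      using L_def[of "D v"] surj by simp
    from this[of "(1, 0)"] this[of "(0, 1)"] show False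
      using nonsing by (simp add: eval2_dir_pderiv q_def \<psi>_def)
  qed
  with L1 show thesis using that by (simp add: \<psi>_def)
qed

text \<open>
  A reduced equation vanishes to first order across its curve. The centre of the chart might a
  priori be a critical point of \<open>f\<close>, so the circle is moved to a parallel disc through a noncritical
  point of the curve.
\<close>

lemma winding_number_transverse_circle:
  assumes f: "squarefree f"
    and \<phi>: "local_coordinates U \<phi> p"
    and curve: "\<phi> ` (curve f \<inter> U) = {w \<in> \<phi> ` U. fst w = 0}"
    and \<epsilon>: "\<epsilon> > 0" "\<And>w. w \<in> cball 0 \<epsilon> \<Longrightarrow> (w, 0) \<in> \<phi> ` U"
  shows "winding_number ((\<lambda>w. eval2 f (inv_into U \<phi> (w, 0))) \<circ> circlepath 0 \<epsilon>) 0 = 1"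
proof -
  define \<psi> where "\<psi> = inv_into U \<phi>"
  have U: "open U" "inj_on \<phi> U" "open (\<phi> ` U)" "holomorphic2_on \<psi> (\<phi> ` U)"
    using \<phi> by (auto simp: local_coordinates_def \<psi>_def)
  have zero_iff: "eval2 f (\<psi> z) = 0 \<longleftrightarrow> fst z = 0" if "z \<in> \<phi> ` U" for z
  proof -
    have z: "\<psi> z \<in> U" "\<phi> (\<psi> z) = z"
      using that by (auto simp: \<psi>_def inv_into_into f_inv_into_f)
    have "\<phi> (\<psi> z) \<in> \<phi> ` (curve f \<inter> U) \<longleftrightarrow> \<psi> z \<in> curve f \<inter> U"
      using inj_on_image_mem_iff[OF U(2), of "\<psi> z" "curve f \<inter> U"] z(1) by auto
    then show ?thesis
      unfolding curve using z that by (simp add: curve_def)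
  qed
  define G where "G z = eval2 f (\<psi> z)" for z
  have contG: "continuous_on (\<phi> ` U) G"
    unfolding G_def using holomorphic2_imp_continuous_on[OF U(4)] by (rule continuous_on_eval2)
  \<comment> \<open>A neighbourhood of the compact disc in the chart contains all parallel discs close to it.\<close>
  have "compact (cball (0::complex) \<epsilon> \<times> {0::complex})"
    by (intro compact_Times) auto
  then obtain \<delta> where \<delta>: "\<delta> > 0" "(\<Union>x\<in>cball 0 \<epsilon> \<times> {0}. ball x \<delta>) \<subseteq> \<phi> ` U"
    using compact_subset_open_imp_ball_epsilon_subset[of "cball 0 \<epsilon> \<times> {0}" "\<phi> ` U"] U(3) \<epsilon>(2) by blast
  have tube: "(w, s) \<in> \<phi> ` U" if "w \<in> cball 0 \<epsilon>" "s \<in> ball 0 \<delta>" for w s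
  proof -
    have "(w, s) \<in> ball (w, 0) \<delta>" using that(2) by (simp add: dist_Pair_Pair)
    then show ?thesis using \<delta>(2) that(1) by blast
  qed
  obtain s where s: "s \<in> ball 0 \<delta>"
    "eval2 (pderiv_x f) (\<psi> (0, s)) \<noteq> 0 \<or> eval2 (pderiv f) (\<psi> (0, s)) \<noteq> 0"
  proof -
    define S where "S = {z. eval2 f z = 0 \<and> eval2 (pderiv_x f) z = 0 \<and> eval2 (pderiv f) z = 0}"
    have "inj_on (\<lambda>s. \<psi> (0, s)) (ball 0 \<delta>)"
    proof (rule inj_onI)
      fix s t assume "s \<in> ball 0 \<delta>" "t \<in> ball 0 \<delta>" "\<psi> (0, s) = \<psi> (0, t)"
      moreover have "inj_on \<psi> (\<phi> ` U)" unfolding \<psi>_def by (rule inj_on_inv_into) simp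
      ultimately show "s = t"
        using tube[of 0] \<epsilon>(1) by (auto dest: inj_onD)
    qed
    moreover have "infinite (ball (0::complex) \<delta>)"
      using \<delta>(1) by (metis ball_eq_empty finite_imp_not_open not_le open_ball)
    ultimately have "infinite ((\<lambda>s. \<psi> (0, s)) ` ball 0 \<delta>)"
      by (simp add: finite_image_iff)
    moreover have "finite S" unfolding S_def by (rule finite_singular_points[OF f])
    ultimately obtain s where s: "s \<in> ball 0 \<delta>" "\<psi> (0, s) \<notin> S"
      by (meson finite_subset image_subsetI)
    moreover have "eval2 f (\<psi> (0, s)) = 0"
      using zero_iff[OF tube[of 0 s]] s(1) \<epsilon>(1) by simp
    ultimately show thesis using that by (auto simp: S_def)
  qed
  obtain d where d: "d \<noteq> 0" "((\<lambda>w. G (w, s)) has_field_derivative d) (at 0)"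
    unfolding G_def \<psi>_def
    by (rule nonsingular_slice_derivative[OF \<phi>, of f s])
       (use zero_iff tube[of 0 s] s \<epsilon>(1) in \<open>auto simp: \<psi>_def\<close>)
  have "winding_number ((\<lambda>w. G (w, s)) \<circ> circlepath 0 \<epsilon>) 0 = 1"
  proof (rule winding_number_simple_zero[OF \<epsilon>(1) _ _ d(2,1)])
    show "continuous_on (cball 0 \<epsilon>) (\<lambda>w. G (w, s))"
      by (rule continuous_on_compose2[OF contG]) (use tube s(1) in \<open>auto intro!: continuous_intros\<close>)
    show "G (w, s) = 0 \<longleftrightarrow> w = 0" if "w \<in> cball 0 \<epsilon>" for w
      using zero_iff[OF tube[OF that s(1)]] by (simp add: G_def)
  qed
  moreover have "winding_number ((\<lambda>w. G (w, 0)) \<circ> circlepath 0 \<epsilon>) 0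
      = winding_number ((\<lambda>w. G (w, s)) \<circ> circlepath 0 \<epsilon>) 0"
  proof (rule winding_number_homotopic_loops)
    let ?A = "sphere (0::complex) \<epsilon> \<times> ball (0::complex) \<delta>"
    have circ: "circlepath 0 \<epsilon> t \<in> sphere 0 \<epsilon>" for t
      using \<epsilon>(1) by (simp add: circlepath norm_mult)
    have cont: "continuous_on {0..1} (circlepath 0 \<epsilon>)"
      using path_circlepath by (simp add: path_def)
    have loop: "circlepath 0 \<epsilon> 1 = circlepath 0 \<epsilon> 0"
      by (simp add: circlepath)
    have "homotopic_loops ?A (\<lambda>t. (circlepath 0 \<epsilon> t, 0)) (\<lambda>t. (circlepath 0 \<epsilon> t, s))"
    proof (rule homotopic_loops_linear)
      fix t :: real
      have "closed_segment (circlepath 0 \<epsilon> t, 0) (circlepath 0 \<epsilon> t, s) \<subseteq> {circlepath 0 \<epsilon> t} \<times> ball 0 \<delta>"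
        using s(1) \<delta>(1) by (intro closed_segment_subset convex_Times) auto
      then show "closed_segment (circlepath 0 \<epsilon> t, 0) (circlepath 0 \<epsilon> t, s) \<subseteq> ?A"
        using circ by blast
    qed (auto simp: path_def pathstart_def pathfinish_def loop intro!: continuous_intros cont)
    then have "homotopic_loops (- {0}) (G \<circ> (\<lambda>t. (circlepath 0 \<epsilon> t, 0))) (G \<circ> (\<lambda>t. (circlepath 0 \<epsilon> t, s)))"
    proof (rule homotopic_loops_continuous_image)
      have sub: "?A \<subseteq> \<phi> ` U" using tube sphere_cball by blast
      then show "continuous_on ?A G" using contG continuous_on_subset by blast
      show "G \<in> ?A \<rightarrow> - {0}"
      proof
        fix z assume z: "z \<in> ?A"
        then have "fst z \<noteq> 0" using \<epsilon>(1) by auto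
        then show "G z \<in> - {0}" using zero_iff[of z] sub z by (auto simp: G_def)
      qed
    qed
    then show "homotopic_loops (- {0}) ((\<lambda>w. G (w, 0)) \<circ> circlepath 0 \<epsilon>) ((\<lambda>w. G (w, s)) \<circ> circlepath 0 \<epsilon>)"
      by (simp add: o_def)
  qed
  ultimately show ?thesis by (simp add: G_def \<psi>_def)
qed

lemma meridian_winding_numbers:
  fixes f :: "'i \<Rightarrow> complex poly poly"
  assumes "squarefree (f i)"
    and \<gamma>: "is_meridian I (\<lambda>k. curve (f k)) i \<gamma>"
  shows "valid_path \<gamma>" "path_image \<gamma> \<subseteq> - (\<Union>k\<in>I. curve (f k))"
    "\<And>j. j \<in> I \<Longrightarrow> winding_number (eval2 (f j) \<circ> \<gamma>) 0 = (if i = j then 1 else 0)"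
proof -
  obtain p U \<phi> \<epsilon> where \<phi>: "local_coordinates U \<phi> p"
    and curve: "\<phi> ` (curve (f i) \<inter> U) = {w \<in> \<phi> ` U. fst w = 0}"
    and "\<epsilon> > 0"
    and disc: "\<forall>w\<in>cball 0 \<epsilon>. (w, 0) \<in> \<phi> ` U \<and> (\<forall>k\<in>I - {i}. inv_into U \<phi> (w, 0) \<notin> curve (f k))"
    and loop: "\<forall>t\<in>{0..1}. \<gamma> t = inv_into U \<phi> (of_real \<epsilon> * exp (2 * of_real pi * \<i> * of_real t), 0)"
    using \<gamma> unfolding is_meridian_def by (elim exE conjE)
  have \<epsilon>: "\<epsilon> > 0" "\<And>w. w \<in> cball 0 \<epsilon> \<Longrightarrow> (w, 0) \<in> \<phi> ` U"
    using \<open>\<epsilon> > 0\<close> disc by blast+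
  have other: "inv_into U \<phi> (w, 0) \<notin> curve (f k)" if "w \<in> cball 0 \<epsilon>" "k \<in> I - {i}" for w k
    using disc that by blast
  have \<gamma>_eq: "\<gamma> t = inv_into U \<phi> (circlepath 0 \<epsilon> t, 0)" if "t \<in> {0..1}" for t
    using loop that by (simp add: circlepath)
  define \<psi> where "\<psi> = inv_into U \<phi>"
  have U: "inj_on \<phi> U" "open (\<phi> ` U)" "holomorphic2_on \<psi> (\<phi> ` U)"
    using \<phi> by (auto simp: local_coordinates_def \<psi>_def)
  have circ: "circlepath 0 \<epsilon> t \<in> cball 0 \<epsilon> - {0}" for t
    using \<epsilon>(1) by (simp add: circlepath norm_mult)
  have "valid_path (\<lambda>t. \<psi> (circlepath 0 \<epsilon> t, 0))"
  proof (rule valid_path_holomorphic_curve[where \<psi> = "\<lambda>w. \<psi> (w, 0)"])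
    show "cball 0 \<epsilon> \<subseteq> {w. (w, 0) \<in> \<phi> ` U}" using \<epsilon>(2) by blast
  qed (intro holomorphic2_slice[OF U(3,2)] \<epsilon>(1))+
  then show "valid_path \<gamma>"
    by (rule valid_path_cong) (simp add: \<gamma>_eq \<psi>_def)
  have h: "winding_number (eval2 (f j) \<circ> \<gamma>) 0
      = winding_number ((\<lambda>w. eval2 (f j) (\<psi> (w, 0))) \<circ> circlepath 0 \<epsilon>) 0" for j
    by (intro winding_number_cong) (simp add: \<gamma>_eq \<psi>_def)
  show "winding_number (eval2 (f j) \<circ> \<gamma>) 0 = (if i = j then 1 else 0)" if "j \<in> I" for j
  proof (cases "i = j")
    case True
    then show ?thesis
      using winding_number_transverse_circle[OF assms(1) \<phi> curve \<epsilon>] by (simp add: h \<psi>_def)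
  next
    case False
    have "continuous_on (cball 0 \<epsilon>) (\<lambda>w. \<psi> (w, 0))"
      by (rule continuous_on_compose2[OF holomorphic2_imp_continuous_on[OF U(3)]])
         (use \<epsilon>(2) in \<open>auto intro!: continuous_intros\<close>)
    then have "continuous_on (cball 0 \<epsilon>) (\<lambda>w. eval2 (f j) (\<psi> (w, 0)))"
      by (rule continuous_on_eval2)
    moreover have "eval2 (f j) (\<psi> (w, 0)) \<noteq> 0" if "w \<in> cball 0 \<epsilon>" for w
      using other[OF that, of j] \<open>j \<in> I\<close> False by (simp add: curve_def \<psi>_def)
    ultimately have "winding_number ((\<lambda>w. eval2 (f j) (\<psi> (w, 0))) \<circ> circlepath 0 \<epsilon>) 0 = 0"
      by (rule winding_number_nonzero[OF \<epsilon>(1)])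
    then show ?thesis using False by (simp add: h)
  qed
  show "path_image \<gamma> \<subseteq> - (\<Union>k\<in>I. curve (f k))"
  proof
    fix z assume "z \<in> path_image \<gamma>"
    then obtain t where t: "t \<in> {0..1}" "z = \<psi> (circlepath 0 \<epsilon> t, 0)"
      using \<gamma>_eq by (auto simp: path_image_def \<psi>_def)
    have V: "(circlepath 0 \<epsilon> t, 0) \<in> \<phi> ` U" using circ \<epsilon>(2) by blast
    have "z \<notin> curve (f i)"
    proof
      assume "z \<in> curve (f i)"
      moreover have "z \<in> U" "\<phi> z = (circlepath 0 \<epsilon> t, 0)"
        using V by (auto simp: t(2) \<psi>_def inv_into_into f_inv_into_f)
      ultimately have "(circlepath 0 \<epsilon> t, 0) \<in> {w \<in> \<phi> ` U. fst w = 0}"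
        unfolding curve[symmetric] by (metis IntI imageI)
      then show False using circ[of t] by simp
    qed
    moreover have "z \<notin> curve (f k)" if "k \<in> I - {i}" for k
      using other[OF _ that] circ t(2) by (auto simp: \<psi>_def)
    ultimately show "z \<in> - (\<Union>k\<in>I. curve (f k))" by auto
  qed
qed

section \<open>Linear independence\<close>

lemma point_off_other_curves:
  assumes "finite I" "i \<in> I" "nonconstant (f i)" "f i \<noteq> 0"
    and "\<And>j. j \<in> I \<Longrightarrow> j \<noteq> i \<Longrightarrow> coprime (f i) (f j)"
  obtains z where "eval2 (f i) z = 0" "\<And>j. j \<in> I \<Longrightarrow> j \<noteq> i \<Longrightarrow> eval2 (f j) z \<noteq> 0"
proof -
  have "finite (\<Union>j\<in>I - {i}. curve (f i) \<inter> curve (f j))"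
    using assms by (intro finite_UN_I finite_intersection_of_coprime_curves) auto
  then have "\<not> curve (f i) \<subseteq> (\<Union>j\<in>I - {i}. curve (f i) \<inter> curve (f j))"
    using infinite_curve[OF assms(3)] finite_subset by blast
  then show thesis using that by (auto simp: curve_def)
qed

text \<open>
  The loop is a small circle around a point \<open>a\<close> of the \<open>i\<close>-th curve in the complex line through
  \<open>a\<close> and a point \<open>b\<close> off that curve. Its winding number \<open>m\<close> is the order of contact of the line
  with the curve.
\<close>

lemma loop_with_one_nonzero_winding_number:
  assumes "finite I" "i \<in> I" "nonconstant (f i)" "squarefree (f i)"
    and "\<And>j. j \<in> I \<Longrightarrow> j \<noteq> i \<Longrightarrow> coprime (f i) (f j)"
  obtains \<gamma> m where "valid_path \<gamma>" "\<gamma> 1 = \<gamma> 0" "m \<noteq> 0"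
    "\<And>t j. j \<in> I \<Longrightarrow> eval2 (f j) (\<gamma> t) \<noteq> 0"
    "\<And>j. j \<in> I \<Longrightarrow> winding_number (eval2 (f j) \<circ> \<gamma>) 0 = (if i = j then of_nat m else 0)"
proof -
  have "f i \<noteq> 0" using assms(4) by auto
  with assms obtain a where a: "eval2 (f i) a = 0" "\<And>j. j \<in> I \<Longrightarrow> j \<noteq> i \<Longrightarrow> eval2 (f j) a \<noteq> 0"
    using point_off_other_curves[of I i f] by metis
  \<comment> \<open>If \<open>f i\<close> vanished everywhere, every point of the plane would be singular.\<close>
  obtain b where b: "eval2 (f i) b \<noteq> 0"
  proof (rule ccontr)
    assume "\<not> thesis"
    then have zero: "eval2 (f i) = (\<lambda>z. 0)" using that by blast
    have "eval2 (dir_pderiv v (f i)) z = 0" for v z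
      using frechet_derivative_eval2[of "f i" z v] by (simp add: zero frechet_derivative_const)
    from this[of "(1, 0)"] this[of "(0, 1)"]
    have "finite (UNIV :: (complex \<times> complex) set)"
      using finite_singular_points[OF assms(4)] by (simp add: eval2_dir_pderiv zero)
    then show False by (simp add: finite_prod infinite_UNIV_char_0)
  qed
  define \<psi> where "\<psi> w = (fst a + w * (fst b - fst a), snd a + w * (snd b - snd a))" for w
  define h where "h j w = eval2 (f j) (\<psi> w)" for j w
  have \<psi>: "(\<lambda>w. fst (\<psi> w)) holomorphic_on A" "(\<lambda>w. snd (\<psi> w)) holomorphic_on A" for A
    unfolding \<psi>_def by (simp_all add: holomorphic_intros)
  have \<psi>01: "\<psi> 0 = a" "\<psi> 1 = b" by (simp_all add: \<psi>_def)
  have h_holo: "h j holomorphic_on A" for j A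
  proof -
    have "(\<lambda>w. eval2 p (\<psi> w)) holomorphic_on A" for p
    proof (induction p)
      case (pCons c p)
      have "poly c holomorphic_on UNIV" by (intro holomorphic_intros)
      from holomorphic_on_compose[OF \<psi>(1)[of A] holomorphic_on_subset[OF this]]
      have "(\<lambda>w. poly c (fst (\<psi> w))) holomorphic_on A" by (simp add: o_def)
      then show ?case
        unfolding eval2_pCons
        by (rule holomorphic_on_add[OF _ holomorphic_on_mult[OF \<psi>(2) pCons.IH]])
    qed simp
    then show ?thesis by (simp add: h_def[abs_def])
  qed
  have h_cont: "continuous_on A (h j)" for A j
    using h_holo by (rule holomorphic_on_imp_continuous_on)
  have nonconst: "\<not> h i constant_on UNIV"
    using a(1) b \<psi>01 unfolding constant_on_def h_def by (metis UNIV_I)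
  have h_0: "h i 0 = 0" using a(1) \<psi>01 by (simp add: h_def)
  obtain u r m where m: "0 < m" "0 < r" "u holomorphic_on ball 0 r"
    "\<And>w. w \<in> ball 0 r \<Longrightarrow> h i w = (w - 0) ^ m * u w" "\<And>w. w \<in> ball 0 r \<Longrightarrow> u w \<noteq> 0"
    by (rule holomorphic_factor_zero_nonconstant[OF h_holo open_UNIV connected_UNIV UNIV_I h_0 nonconst])
      (rule that; assumption)
  have "open (\<Inter>j\<in>I - {i}. {w. h j w \<noteq> 0})"
    using assms(1) by (intro open_INT ballI open_Collect_neq h_cont continuous_on_const) auto
  moreover have "0 \<in> (\<Inter>j\<in>I - {i}. {w. h j w \<noteq> 0})"
    using a(2) \<psi>01 by (auto simp: h_def)
  ultimately obtain e where e: "e > 0" "cball 0 e \<subseteq> (\<Inter>j\<in>I - {i}. {w. h j w \<noteq> 0})"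
    unfolding open_contains_cball by blast
  define \<rho> where "\<rho> = min e (r / 2)"
  have \<rho>: "\<rho> > 0" "cball 0 \<rho> \<subseteq> ball (0::complex) r" "cball 0 \<rho> \<subseteq> cball (0::complex) e"
    using e(1) m(2) by (auto simp: \<rho>_def)
  have circ: "circlepath 0 \<rho> t \<in> cball 0 \<rho>" "circlepath 0 \<rho> t \<noteq> 0" for t
    using \<rho>(1) by (simp_all add: circlepath norm_mult)
  show thesis
  proof (rule that[of "\<lambda>t. \<psi> (circlepath 0 \<rho> t)" m])
    show "valid_path (\<lambda>t. \<psi> (circlepath 0 \<rho> t))"
      by (rule valid_path_holomorphic_curve[OF open_UNIV subset_UNIV \<rho>(1) \<psi>])
    show "\<psi> (circlepath 0 \<rho> 1) = \<psi> (circlepath 0 \<rho> 0)"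
      by (simp add: circlepath)
    show "m \<noteq> 0" using m(1) by simp
    show "eval2 (f j) (\<psi> (circlepath 0 \<rho> t)) \<noteq> 0" if "j \<in> I" for j t
    proof (cases "j = i")
      case True
      have "circlepath 0 \<rho> t \<in> ball 0 r" using circ(1) \<rho>(2) by blast
      then have "h i (circlepath 0 \<rho> t) \<noteq> 0" using m(4,5) circ(2) by simp
      then show ?thesis using True by (simp add: h_def)
    next
      case False
      then show ?thesis using circ(1)[of t] \<rho>(3) e(2) that unfolding h_def by blast
    qed
    show "winding_number (eval2 (f j) \<circ> (\<lambda>t. \<psi> (circlepath 0 \<rho> t))) 0 = (if i = j then of_nat m else 0)"
      if "j \<in> I" for j
    proof -
      have "winding_number (h j \<circ> circlepath 0 \<rho>) 0 = (if i = j then of_nat m else 0)"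
      proof (cases "i = j")
        case True
        have "continuous_on (cball 0 \<rho>) u"
          using continuous_on_subset[OF holomorphic_on_imp_continuous_on[OF m(3)] \<rho>(2)] .
        moreover have "u w \<noteq> 0" if "w \<in> cball 0 \<rho>" for w
          using m(5) \<rho>(2) that by blast
        moreover have "h i w = (w - 0) ^ m * u w" if "w \<in> sphere 0 \<rho>" for w
          using m(4) \<rho>(2) that sphere_cball by blast
        ultimately have "winding_number (h i \<circ> circlepath 0 \<rho>) 0 = of_nat m"
          by (rule winding_number_power_times_nonzero[OF \<rho>(1)])
        then show ?thesis using True by simp
      next
        case False
        have "h j w \<noteq> 0" if "w \<in> cball 0 \<rho>" for w
          using that \<rho>(3) e(2) False \<open>j \<in> I\<close> by blast
        then have "winding_number (h j \<circ> circlepath 0 \<rho>) 0 = 0"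
          by (rule winding_number_nonzero[OF \<rho>(1) h_cont])
        then show ?thesis using False by simp
      qed
      then show ?thesis by (simp add: h_def o_def)
    qed
  qed
qed

text \<open>
  Comparing the integral of an exact form over such a loop, which is \<open>0\<close>, with the combination of
  winding numbers isolates the coefficient \<open>c i\<close>.
\<close>

lemma exact_dlog_combination:
  fixes c :: "'i \<Rightarrow> complex"
  assumes "finite I" "\<And>i. i \<in> I \<Longrightarrow> nonconstant (f i)" "\<And>i. i \<in> I \<Longrightarrow> squarefree (f i)"
    and "\<And>i j. i \<in> I \<Longrightarrow> j \<in> I \<Longrightarrow> i \<noteq> j \<Longrightarrow> coprime (f i) (f j)"
    and exact: "exact_one_form (- (\<Union>i\<in>I. curve (f i))) (\<lambda>z v. \<Sum>j\<in>I. c j * dlog_form (f j) z v)"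
    and "i \<in> I"
  shows "c i = 0"
proof -
  let ?U = "- (\<Union>i\<in>I. curve (f i))"
  obtain \<gamma> m where \<gamma>: "valid_path \<gamma>" "\<gamma> 1 = \<gamma> 0" "m \<noteq> 0"
    "\<And>t j. j \<in> I \<Longrightarrow> eval2 (f j) (\<gamma> t) \<noteq> 0"
    "\<And>j. j \<in> I \<Longrightarrow> winding_number (eval2 (f j) \<circ> \<gamma>) 0 = (if i = j then of_nat m else 0)"
    using loop_with_one_nonzero_winding_number[of I i f] assms(1-4,6) by metis
  obtain g where g: "smooth_on ?U g"
    "\<And>z. z \<in> ?U \<Longrightarrow> (\<lambda>v. \<Sum>j\<in>I. c j * dlog_form (f j) z v) = frechet_derivative g (at z)"
    using exact unfolding exact_one_form_def by blast
  have U: "\<gamma> t \<in> ?U" for t using \<gamma>(4) by (auto simp: curve_def)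
  let ?d = "\<lambda>t. vector_derivative \<gamma> (at t within {0..1})"
  have "((\<lambda>t. frechet_derivative g (at (\<gamma> t)) (?d t)) has_integral g (\<gamma> 1) - g (\<gamma> 0)) {0..1}"
    using smooth_onD[OF g(1) U] by (rule has_integral_differential[OF \<gamma>(1)])
  then have "((\<lambda>t. \<Sum>j\<in>I. c j * dlog_form (f j) (\<gamma> t) (?d t)) has_integral 0) {0..1}"
    using \<gamma>(2) by (simp add: g(2)[OF U, symmetric])
  moreover have "((\<lambda>t. \<Sum>j\<in>I. c j * dlog_form (f j) (\<gamma> t) (?d t)) has_integral
      (\<Sum>j\<in>I. c j * (2 * of_real pi * \<i> * winding_number (eval2 (f j) \<circ> \<gamma>) 0))) {0..1}"
    using \<gamma>(4) by (intro has_integral_sum[OF assms(1)] has_integral_mult_right has_integral_dlog_form[OF \<gamma>(1)])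
  ultimately have "0 = (\<Sum>j\<in>I. c j * (2 * of_real pi * \<i> * winding_number (eval2 (f j) \<circ> \<gamma>) 0))"
    by (rule has_integral_unique)
  also have "\<dots> = (\<Sum>j\<in>I. if i = j then c i * (2 * of_real pi * \<i> * of_nat m) else 0)"
    by (intro sum.cong) (auto simp: \<gamma>(5))
  also have "\<dots> = c i * (2 * of_real pi * \<i> * of_nat m)"
    using assms(1,6) by simp
  finally show ?thesis using \<gamma>(3) by simp
qed

lemma finsum_deRham_class:
  assumes U: "open U" and "finite A" "\<And>j. j \<in> A \<Longrightarrow> closed_one_form U (\<omega> j)"
  shows "closed_one_form U (\<lambda>x v. \<Sum>j\<in>A. c j * \<omega> j x v)"
    "(\<Oplus>\<^bsub>deRham_H1 U\<^esub>j\<in>A. c j \<odot>\<^bsub>deRham_H1 U\<^esub> deRham_class U (\<omega> j))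
      = deRham_class U (\<lambda>x v. \<Sum>j\<in>A. c j * \<omega> j x v)"
proof -
  interpret M: Module.module complex_field "deRham_H1 U" by (rule module_deRham_H1[OF U])
  have "closed_one_form U (\<lambda>x v. \<Sum>j\<in>A. c j * \<omega> j x v) \<and>
    (\<Oplus>\<^bsub>deRham_H1 U\<^esub>j\<in>A. c j \<odot>\<^bsub>deRham_H1 U\<^esub> deRham_class U (\<omega> j))
      = deRham_class U (\<lambda>x v. \<Sum>j\<in>A. c j * \<omega> j x v)"
    using assms(2,3)
  proof (induction A rule: finite_induct)
    case empty
    have "\<zero>\<^bsub>deRham_H1 U\<^esub> = deRham_class U (\<lambda>x v. 0)" by (simp add: deRham_H1_def)
    then show ?case by (simp add: closed_one_form_zero)
  next
    case (insert k A)
    have cl: "closed_one_form U (\<lambda>x v. c j * \<omega> j x v)" if "j \<in> insert k A" for j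
      using insert.prems[OF that] by (rule closed_one_form_cmult[OF U])
    have smult: "c j \<odot>\<^bsub>deRham_H1 U\<^esub> deRham_class U (\<omega> j) = deRham_class U (\<lambda>x v. c j * \<omega> j x v)"
      if "j \<in> insert k A" for j
      using insert.prems[OF that] by (rule deRham_H1_smult[OF U])
    have "c j \<odot>\<^bsub>deRham_H1 U\<^esub> deRham_class U (\<omega> j) \<in> carrier (deRham_H1 U)" if "j \<in> insert k A" for j
      unfolding smult[OF that] using cl[OF that] by (auto simp: deRham_H1_def)
    then have "(\<Oplus>\<^bsub>deRham_H1 U\<^esub>j\<in>insert k A. c j \<odot>\<^bsub>deRham_H1 U\<^esub> deRham_class U (\<omega> j))
       = deRham_class U (\<lambda>x v. c k * \<omega> k x v) \<oplus>\<^bsub>deRham_H1 U\<^esub> deRham_class U (\<lambda>x v. \<Sum>j\<in>A. c j * \<omega> j x v)"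
      using insert by (subst M.finsum_insert) (auto simp: smult Pi_def)
    then show ?case
      using insert closed_one_form_add[OF U cl[of k]] by (simp add: deRham_H1_add[OF U cl])
  qed
  then show "closed_one_form U (\<lambda>x v. \<Sum>j\<in>A. c j * \<omega> j x v)"
    "(\<Oplus>\<^bsub>deRham_H1 U\<^esub>j\<in>A. c j \<odot>\<^bsub>deRham_H1 U\<^esub> deRham_class U (\<omega> j))
      = deRham_class U (\<lambda>x v. \<Sum>j\<in>A. c j * \<omega> j x v)" by blast+
qed

theorem theorem5p18:
  fixes n :: nat and f :: "nat \<Rightarrow> complex poly poly"
  assumes "\<And>i. i \<in> {1..n} \<Longrightarrow> nonconstant (f i)"
    and "\<And>i. i \<in> {1..n} \<Longrightarrow> squarefree (f i)"
    and "\<And>i j. i \<in> {1..n} \<Longrightarrow> j \<in> {1..n} \<Longrightarrow> i \<noteq> j \<Longrightarrow> coprime (f i) (f j)"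
  shows
    "(\<forall>i\<in>{1..n}. \<forall>\<delta>. meridian_class n f i \<delta> \<longrightarrow>
        (\<forall>j\<in>{1..n}. 1 / (2 * of_real pi * \<i>) * class_integral (dlog_form (f j)) \<delta>
                    = (if i = j then 1 else 0))) \<and>
     (let H = deRham_H1 (curve_complement n f);
          cls = (\<lambda>j. deRham_class (curve_complement n f) (dlog_form (f j)))
      in \<forall>c :: nat \<Rightarrow> complex.
           (\<Oplus>\<^bsub>H\<^esub>j\<in>{1..n}. c j \<odot>\<^bsub>H\<^esub> cls j) = \<zero>\<^bsub>H\<^esub> \<longrightarrow> (\<forall>j\<in>{1..n}. c j = 0))"
proof (intro conjI)
  let ?U = "curve_complement n f"
  have U: "open ?U" by (rule open_curve_complement)
  have nonzero: "eval2 (f j) z \<noteq> 0" if "z \<in> ?U" "j \<in> {1..n}" for z j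
    using that by (auto simp: curve_complement_def curve_def)
  show "\<forall>i\<in>{1..n}. \<forall>\<delta>. meridian_class n f i \<delta> \<longrightarrow>
      (\<forall>j\<in>{1..n}. 1 / (2 * of_real pi * \<i>) * class_integral (dlog_form (f j)) \<delta>
        = (if i = j then 1 else 0))"
  proof (intro ballI allI impI)
    fix i \<delta> j assume i: "i \<in> {1..n}" and \<delta>: "meridian_class n f i \<delta>" and j: "j \<in> {1..n}"
    obtain \<gamma> where \<gamma>: "is_meridian {1..n} (\<lambda>k. curve (f k)) i \<gamma>" "\<delta> = loop_class ?U \<gamma>"
      using \<delta> by (auto simp: meridian_class_def)
    note M = meridian_winding_numbers[OF assms(2)[OF i] \<gamma>(1)]
    have "class_integral (dlog_form (f j)) \<delta> = 2 * of_real pi * \<i> * winding_number (eval2 (f j) \<circ> \<gamma>) 0"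
      unfolding \<gamma>(2) using M(1,2) nonzero j
      by (intro class_integral_dlog_form) (simp_all add: curve_complement_def)
    then show "1 / (2 * of_real pi * \<i>) * class_integral (dlog_form (f j)) \<delta> = (if i = j then 1 else 0)"
      by (simp add: M(3)[OF j])
  qed
  have closed: "closed_one_form ?U (dlog_form (f j))" if "j \<in> {1..n}" for j
    using closed_dlog_form[OF U] nonzero that by blast
  show "let H = deRham_H1 ?U; cls = (\<lambda>j. deRham_class ?U (dlog_form (f j)))
      in \<forall>c :: nat \<Rightarrow> complex.
        (\<Oplus>\<^bsub>H\<^esub>j\<in>{1..n}. c j \<odot>\<^bsub>H\<^esub> cls j) = \<zero>\<^bsub>H\<^esub> \<longrightarrow> (\<forall>j\<in>{1..n}. c j = 0)"
    unfolding Let_def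
  proof (intro allI impI ballI)
    fix c :: "nat \<Rightarrow> complex" and i
    assume zero: "(\<Oplus>\<^bsub>deRham_H1 ?U\<^esub>j\<in>{1..n}. c j \<odot>\<^bsub>deRham_H1 ?U\<^esub> deRham_class ?U (dlog_form (f j)))
      = \<zero>\<^bsub>deRham_H1 ?U\<^esub>" and i: "i \<in> {1..n}"
    have sum: "closed_one_form ?U (\<lambda>z v. \<Sum>j\<in>{1..n}. c j * dlog_form (f j) z v)"
      "(\<Oplus>\<^bsub>deRham_H1 ?U\<^esub>j\<in>{1..n}. c j \<odot>\<^bsub>deRham_H1 ?U\<^esub> deRham_class ?U (dlog_form (f j)))
        = deRham_class ?U (\<lambda>z v. \<Sum>j\<in>{1..n}. c j * dlog_form (f j) z v)"
      by (rule finsum_deRham_class[OF U finite_atLeastAtMost closed]; assumption)+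
    have "deRham_class ?U (\<lambda>z v. \<Sum>j\<in>{1..n}. c j * dlog_form (f j) z v) = deRham_class ?U (\<lambda>z v. 0)"
      using zero sum(2) by (simp add: deRham_H1_def)
    then have "exact_one_form ?U (\<lambda>z v. \<Sum>j\<in>{1..n}. c j * dlog_form (f j) z v)"
      using deRham_class_eq_iff[OF U sum(1), of "\<lambda>z v. 0"] by simp
    then show "c i = 0"
      using assms i unfolding curve_complement_def
      by (intro exact_dlog_combination[of "{1..n}" f c i]) auto
  qed
qed

end
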